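(* Let $X$ be a simply connected space whose Sullivan minimal model is $M(X)=(\Lambda(v_1,v_2,\dots,v_n),d)$ with all degrees $|v_i|$ odd and $1<|v_1|\le|v_2|\le\cdots\le|v_n|$. If $X$ is pre-c-symplectic, then $n$ is odd and $|v_i|+|v_{n-i}|\le |v_n|+1$ for every $i=1,\dots,(n-1)/2$, i.e. $|v_1|+|v_{n-1}|\le|v_n|+1$, $|v_2|+|v_{n-2}|\le|v_n|+1$, $\dots$, $|v_{(n-1)/2}|+|v_{(n+1)/2}|\le|v_n|+1$.
   Context: For a space $Y$ with finite-dimensional rational cohomology, the formal dimension is $fd(Y)=\max\{i : H^i(Y;\mathbb{Q})\neq 0\}$. $Y$ is a rationally Poincaré dual space if $H^*(Y;\mathbb{Q})$ is a Poincaré duality algebra. A rationally Poincaré dual space $Y$ with $fd(Y)=2m$ is c-symplectic (cohomologically symplectic) if there is $\omega\in H^2(Y;\mathbb{Q})$ such that $\omega^m\ne 0$ in $H^{2m}(Y;\mathbb{Q})$. A simply connected space $X$ is pre-c-symplectic if it is the fibre of a (rational) fibration $X\to Y\to \mathbb{C}P^\infty$ where $Y$ is c-symplectic. This depends only on the rational homotopy type of $X$: if $(\Lambda V,d)$ is the Sullivan minimal model of $X$, it means that there is a relative Sullivan model $(\mathbb{Q}[t],0)\to(\mathbb{Q}[t]\otimes\Lambda V,D)\to(\Lambda V,d)$ with $|t|=2$, $Dt=0$, $Dv\equiv dv$ modulo the ideal $(t)$ for $v\in V$, such that $(\mathbb{Q}[t]\otimes\Lambda V,D)$ is the model of a c-symplectic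 space. $\Lambda(v_1,\dots,v_n)$ denotes the free graded-commutative $\mathbb{Q}$-algebra on the $v_i$; the differential $d$ is decomposable. *)

theory Defs
  imports
    Complex_Main
    "HOL-Library.Poly_Mapping"
    "HOL-Algebra.QuotRing"
    "HOL-Algebra.Module"
begin

section \<open>Differential graded algebras over the rationals and their cohomology\<close>

text \<open>
  A graded \<open>\<rat>\<close>-algebra is a module record together with its homogeneous
  components. A differential is kept as a separate function; only its values on the
  carrier matter.
\<close>

record 'a graded_algebra = "(rat, 'a) module" +
  component :: "nat \<Rightarrow> 'a set"

definition is_differential :: "('a, 'b) graded_algebra_scheme \<Rightarrow> ('a \<Rightarrow> 'a) \<Rightarrow> bool" where
  "is_differential A d \<longleftrightarrow>
     d \<in> carrier A \<rightarrow> carrier A \<and>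
     (\<forall>x\<in>carrier A. \<forall>y\<in>carrier A. d (x \<oplus>\<^bsub>A\<^esub> y) = d x \<oplus>\<^bsub>A\<^esub> d y) \<and>
     (\<forall>c. \<forall>x\<in>carrier A. d (c \<odot>\<^bsub>A\<^esub> x) = c \<odot>\<^bsub>A\<^esub> d x) \<and>
     (\<forall>k. \<forall>x\<in>component A k. d x \<in> component A (Suc k)) \<and>
     (\<forall>k. \<forall>x\<in>component A k. \<forall>y\<in>carrier A.
        d (x \<otimes>\<^bsub>A\<^esub> y) = d x \<otimes>\<^bsub>A\<^esub> y \<oplus>\<^bsub>A\<^esub> ((- 1) ^ k) \<odot>\<^bsub>A\<^esub> (x \<otimes>\<^bsub>A\<^esub> d y)) \<and>
     (\<forall>x\<in>carrier A. d (d x) = \<zero>\<^bsub>A\<^esub>)"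

definition cocycles :: "('a, 'b) graded_algebra_scheme \<Rightarrow> ('a \<Rightarrow> 'a) \<Rightarrow> 'a set" where
  "cocycles A d = {x \<in> carrier A. d x = \<zero>\<^bsub>A\<^esub>}"

definition coboundaries :: "('a, 'b) graded_algebra_scheme \<Rightarrow> ('a \<Rightarrow> 'a) \<Rightarrow> 'a set" where
  "coboundaries A d = d ` carrier A"

definition cohomology_ring :: "('a, 'b) graded_algebra_scheme \<Rightarrow> ('a \<Rightarrow> 'a) \<Rightarrow> 'a set ring" where
  "cohomology_ring A d = (A\<lparr>carrier := cocycles A d\<rparr>) Quot (coboundaries A d)"

text \<open>The scalar action is defined through cosets of representatives, so that it is
  correct for the scalar \<open>0\<close> as well.\<close>

definition cohomology ::
  "('a, 'b) graded_algebra_scheme \<Rightarrow> ('a \<Rightarrow> 'a) \<Rightarrow> 'a set graded_algebra" where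
  "cohomology A d =
    \<lparr>carrier = carrier (cohomology_ring A d),
     mult = mult (cohomology_ring A d),
     one = one (cohomology_ring A d),
     zero = zero (cohomology_ring A d),
     add = add (cohomology_ring A d),
     smult = (\<lambda>c X. \<Union>x\<in>X. coboundaries A d +>\<^bsub>A\<^esub> (c \<odot>\<^bsub>A\<^esub> x)),
     component = (\<lambda>k. (\<lambda>x. coboundaries A d +>\<^bsub>A\<^esub> x) ` (cocycles A d \<inter> component A k))\<rparr>"


section \<open>Poincare duality and the c-symplectic condition\<close>

definition finite_dimensional :: "('a, 'b) graded_algebra_scheme \<Rightarrow> bool" where
  "finite_dimensional H \<longleftrightarrow>
     (\<exists>S. finite S \<and> S \<subseteq> carrier H \<and>
       (\<forall>x\<in>carrier H. \<exists>c. x = (\<Oplus>\<^bsub>H\<^esub> s\<in>S. c s \<odot>\<^bsub>H\<^esub> s)))"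

text \<open>Meaningful for nonzero finite-dimensional \<open>H\<close> only, when the set of nonzero degrees
  is finite and nonempty.\<close>

definition formal_dimension :: "('a, 'b) graded_algebra_scheme \<Rightarrow> nat" where
  "formal_dimension H = Max {i. component H i \<noteq> {\<zero>\<^bsub>H\<^esub>}}"

text \<open>To be applied to the cohomology of a commutative differential graded algebra; by graded
  commutativity, nondegeneracy of the pairings in the left argument (in all degrees)
  is nondegeneracy on both sides.\<close>

definition poincare_duality_algebra :: "('a, 'b) graded_algebra_scheme \<Rightarrow> bool" where
  "poincare_duality_algebra H \<longleftrightarrow>
     finite_dimensional H \<and>
     (\<exists>u\<in>component H (formal_dimension H). u \<noteq> \<zero>\<^bsub>H\<^esub> \<and>
        (\<forall>x\<in>component H (formal_dimension H). \<exists>c. x = c \<odot>\<^bsub>H\<^esub> u)) \<and>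
     (\<forall>i\<le>formal_dimension H. \<forall>x\<in>component H i. x \<noteq> \<zero>\<^bsub>H\<^esub> \<longrightarrow>
        (\<exists>y\<in>component H (formal_dimension H - i). x \<otimes>\<^bsub>H\<^esub> y \<noteq> \<zero>\<^bsub>H\<^esub>))"

definition c_symplectic :: "('a, 'b) graded_algebra_scheme \<Rightarrow> bool" where
  "c_symplectic H \<longleftrightarrow>
     poincare_duality_algebra H \<and>
     (\<exists>m. formal_dimension H = 2 * m \<and>
        (\<exists>\<omega>\<in>component H 2. \<omega> [^]\<^bsub>H\<^esub> m \<noteq> \<zero>\<^bsub>H\<^esub>))"


section \<open>Free graded-commutative algebras\<close>

text \<open>
  Generators are indexed by a set of natural numbers \<open>I\<close>, the generator \<open>i\<close> having degree
  \<open>deg i\<close>. The exponent vector \<open>a\<close> stands for the product of the powers \<open>x\<^sub>i\<close> to the \<open>a i\<close>,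
  taken in increasing order of \<open>i\<close>; generators of odd degree have exponent at most one.
  The type of elements carries a commutative convolution product \<open>(*)\<close> from the library,
  which is not the product of the algebra.
\<close>

type_synonym monomial = "nat \<Rightarrow>\<^sub>0 nat"
type_synonym gca = "monomial \<Rightarrow>\<^sub>0 rat"

definition admissible :: "(nat \<Rightarrow> nat) \<Rightarrow> monomial \<Rightarrow> bool" where
  "admissible deg a \<longleftrightarrow> (\<forall>i. odd (deg i) \<longrightarrow> Poly_Mapping.lookup a i \<le> 1)"

definition monomial_degree :: "(nat \<Rightarrow> nat) \<Rightarrow> monomial \<Rightarrow> nat" where
  "monomial_degree deg a = (\<Sum>i\<in>Poly_Mapping.keys a. deg i * Poly_Mapping.lookup a i)"

definition word_length :: "monomial \<Rightarrow> nat" where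
  "word_length a = (\<Sum>i\<in>Poly_Mapping.keys a. Poly_Mapping.lookup a i)"

text \<open>Koszul sign: every power of \<open>x\<^sub>j\<close> in \<open>b\<close> is moved to the left past every power
  of \<open>x\<^sub>i\<close> in \<open>a\<close> with \<open>i > j\<close>.\<close>

definition koszul_sign :: "(nat \<Rightarrow> nat) \<Rightarrow> monomial \<Rightarrow> monomial \<Rightarrow> rat" where
  "koszul_sign deg a b =
     (- 1) ^ (\<Sum>i\<in>Poly_Mapping.keys a. \<Sum>j\<in>{j \<in> Poly_Mapping.keys b. j < i}.
       (deg i * Poly_Mapping.lookup a i) * (deg j * Poly_Mapping.lookup b j))"

definition gca_mult :: "(nat \<Rightarrow> nat) \<Rightarrow> gca \<Rightarrow> gca \<Rightarrow> gca" where
  "gca_mult deg x y =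
     (\<Sum>a\<in>Poly_Mapping.keys x. \<Sum>b\<in>Poly_Mapping.keys y.
       if admissible deg (a + b)
       then Poly_Mapping.single (a + b)
              (koszul_sign deg a b * Poly_Mapping.lookup x a * Poly_Mapping.lookup y b)
       else 0)"

definition free_gca :: "nat set \<Rightarrow> (nat \<Rightarrow> nat) \<Rightarrow> gca graded_algebra" where
  "free_gca I deg =
    \<lparr>carrier = {x. \<forall>a\<in>Poly_Mapping.keys x. Poly_Mapping.keys a \<subseteq> I \<and> admissible deg a},
     mult = gca_mult deg,
     one = Poly_Mapping.single 0 1,
     zero = 0,
     add = (+),
     smult = (\<lambda>c. Poly_Mapping.map ((*) c)),
     component = (\<lambda>k. {x. \<forall>a\<in>Poly_Mapping.keys x.
        Poly_Mapping.keys a \<subseteq> I \<and> admissible deg a \<and> monomial_degree deg a = k})\<rparr>"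

definition gen :: "nat \<Rightarrow> gca" where
  "gen i = Poly_Mapping.single (Poly_Mapping.single i 1) 1"

text \<open>The linear span of the generators indexed by \<open>J\<close>.\<close>

definition generating_space :: "nat set \<Rightarrow> gca set" where
  "generating_space J = {x. Poly_Mapping.keys x \<subseteq> (\<lambda>i. Poly_Mapping.single i 1) ` J}"

inductive_set subalgebra_span :: "('a, 'b) graded_algebra_scheme \<Rightarrow> 'a set \<Rightarrow> 'a set"
  for A S where
  base: "x \<in> S \<Longrightarrow> x \<in> subalgebra_span A S"
| unit: "\<one>\<^bsub>A\<^esub> \<in> subalgebra_span A S"
| smult: "x \<in> subalgebra_span A S \<Longrightarrow> c \<odot>\<^bsub>A\<^esub> x \<in> subalgebra_span A S"
| add: "x \<in> subalgebra_span A S \<Longrightarrow> y \<in> subalgebra_span A S \<Longrightarrow> x \<oplus>\<^bsub>A\<^esub> y \<in> subalgebra_span A S"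
| mult: "x \<in> subalgebra_span A S \<Longrightarrow> y \<in> subalgebra_span A S \<Longrightarrow> x \<otimes>\<^bsub>A\<^esub> y \<in> subalgebra_span A S"


section \<open>Sullivan algebras\<close>

definition rat_ring :: "rat ring" where
  "rat_ring = \<lparr>carrier = UNIV, mult = (*), one = 1, zero = 0, add = (+)\<rparr>"

text \<open>
  Relative Sullivan algebra \<open>(\<Lambda>B \<otimes> \<Lambda>V, d)\<close> over a base \<open>(\<Lambda>B, d)\<close> that is itself free, where
  \<open>V\<close> has basis the generators indexed by \<open>J\<close>; the tensor product is the free algebra on all
  the generators. \<open>F k j\<close> is the degree \<open>j\<close> part of the \<open>k\<close>-th step \<open>V(k)\<close> of the filtration
  of the graded vector space \<open>V\<close>, with \<open>d\<close> sending \<open>V(0)\<close> to \<open>\<Lambda>B\<close> and \<open>V(k+1)\<close> to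
  \<open>\<Lambda>B \<otimes> \<Lambda>V(k)\<close>. For empty \<open>B\<close> the former says that \<open>d\<close> vanishes on \<open>V(0)\<close>, since then
  \<open>\<Lambda>B = \<rat>\<close> lives in degree zero.
\<close>

definition relative_sullivan_algebra ::
  "nat set \<Rightarrow> nat set \<Rightarrow> (nat \<Rightarrow> nat) \<Rightarrow> (gca \<Rightarrow> gca) \<Rightarrow> bool" where
  "relative_sullivan_algebra B J deg d \<longleftrightarrow>
     (let A = free_gca (B \<union> J) deg in
       B \<inter> J = {} \<and>
       (\<forall>j\<in>J. 1 \<le> deg j) \<and>
       is_differential A d \<and>
       (\<forall>b\<in>B. d (gen b) \<in> carrier (free_gca B deg)) \<and>
       (\<exists>F :: nat \<Rightarrow> nat \<Rightarrow> gca set.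
         (\<forall>k j. submodule (F k j) rat_ring A) \<and>
         (\<forall>k j. F k j \<subseteq> F (Suc k) j) \<and>
         (\<forall>j. (\<Union>k. F k j) = generating_space J \<inter> component A j) \<and>
         (\<forall>j. \<forall>v\<in>F 0 j. d v \<in> carrier (free_gca B deg)) \<and>
         (\<forall>k j. \<forall>v\<in>F (Suc k) j. d v \<in> subalgebra_span A (gen ` B \<union> (\<Union>l. F k l)))))"

definition minimal_sullivan_algebra ::
  "nat set \<Rightarrow> (nat \<Rightarrow> nat) \<Rightarrow> (gca \<Rightarrow> gca) \<Rightarrow> bool" where
  "minimal_sullivan_algebra J deg d \<longleftrightarrow>
     relative_sullivan_algebra {} J deg d \<and>
     (\<forall>v\<in>generating_space J. \<forall>a\<in>Poly_Mapping.keys (d v). 2 \<le> word_length a)"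

text \<open>
  Pre-c-symplectic simply connected space, in terms of its minimal model
  \<open>(\<Lambda>(v\<^sub>1,\<dots>,v\<^sub>n), d)\<close>: the generators \<open>v\<^sub>i\<close> have indices \<open>1,\<dots>,n\<close>, and the generator \<open>t\<close> of the
  base \<open>\<rat>[t]\<close> gets the index \<open>0\<close>, so that \<open>\<Lambda>V\<close> is a subset of \<open>\<rat>[t] \<otimes> \<Lambda>V\<close>.
  The value of \<open>deg\<close> at \<open>0\<close> is irrelevant. The cohomology of the total algebra is the rational
  cohomology algebra of the total space, which is required to be c-symplectic.
\<close>

definition pre_c_symplectic :: "nat \<Rightarrow> (nat \<Rightarrow> nat) \<Rightarrow> (gca \<Rightarrow> gca) \<Rightarrow> bool" where
  "pre_c_symplectic n deg d \<longleftrightarrow>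
     (let degt = deg(0 := 2); A = free_gca {0..n} degt in
       \<exists>D. relative_sullivan_algebra {0} {1..n} degt D \<and>
           D (gen 0) = \<zero>\<^bsub>A\<^esub> \<and>
           (\<forall>v\<in>generating_space {1..n}. D v - d v \<in> PIdl\<^bsub>A\<^esub> (gen 0)) \<and>
           c_symplectic (cohomology A D))"

end

theory Submission
  imports Defs
begin

text \<open>
  Let \<open>A = \<rat>[t] \<otimes> \<Lambda>(v\<^sub>1,\<dots>,v\<^sub>n)\<close> with differential \<open>D\<close> be the model of the c-symplectic total space, of
  formal dimension \<open>2m\<close>, and let \<open>N = |v\<^sub>1| + \<dots> + |v\<^sub>n|\<close>. Two facts about \<open>A\<close> pull against
  each other.

  On the one hand, \<open>t\<^sup>m\<close> is not exact. All generators but \<open>t\<close> have degree at least three, so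
  the symplectic class is a multiple of \<open>t\<close> (lemma \<open>c_symplectic_t_power_not_exact\<close>). Moreover
  \<open>N \<le> 2m + 1\<close>, because the product of all \<open>v\<^sub>i\<close> is a nonzero class of the fibre, which by the
  Gysin sequence forces cohomology of the total space in degree \<open>N\<close> or \<open>N - 1\<close>
  (lemma \<open>nonzero_cohomology_near_top_degree\<close>).
  Hence every homogeneous \<open>z\<close> whose differential is a nonzero multiple of a power of \<open>t\<close> contains a
  monomial \<open>t\<^sup>b v\<^sub>1\<cdots>v\<^sub>n\<close>: otherwise each of its monomials has degree at most \<open>N - 3\<close> in the \<open>v\<^sub>i\<close>, so
  that a high power of \<open>t\<close> divides \<open>z\<close>, and cancelling it (or multiplying, if the power is low)
  makes \<open>t\<^sup>m\<close> exact (lemma \<open>full_monomial_in_primitive\<close>).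

  On the other hand, the cohomology is finite-dimensional, so some power of \<open>t\<close> is exact. Comparing
  the parity of the degrees shows at once that \<open>n\<close> is odd. It also follows that \<open>D v\<^sub>l = c t\<^sup>e + \<alpha>\<close>
  for some \<open>l\<close>, with \<open>c \<noteq> 0\<close> and \<open>\<alpha>\<close> a nilpotent cocycle in the ideal of the \<open>v\<^sub>i\<close>. Up to powers of \<open>c t\<^sup>e\<close>, the
  geometric series \<open>z = v\<^sub>l (1 - \<alpha> + \<alpha>\<^sup>2 - \<dots>)\<close> is a primitive of a power of \<open>t\<close>
  (lemma \<open>primitive_with_nonnegative_weights\<close>). A monomial of \<open>z\<close> involving every \<open>v\<^sub>i\<close> splits
  the generators other than \<open>v\<^sub>l\<close> into blocks, one for each factor \<open>\<alpha>\<close>, each with at least two elements and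
  total degree at most \<open>|v\<^sub>l| + 1 \<le> |v\<^sub>n| + 1\<close>. If \<open>|v\<^sub>i| + |v\<^sub>n\<^sub>-\<^sub>i| > |v\<^sub>n| + 1\<close>, then two generators
  with indices at least \<open>i\<close> and at least \<open>n - i\<close> never share a block; so the generators with
  index at least \<open>n - i\<close>, of which at least \<open>i\<close> differ from \<open>v\<^sub>l\<close>, lie in different blocks,
  and each needs a partner of its own among the \<open>i - 1\<close> generators with index less than \<open>i\<close>. The
  pigeonhole principle excludes this (lemma \<open>degree_inequality\<close>).
\<close>

abbreviation keys where "keys \<equiv> Poly_Mapping.keys"
abbreviation lookup where "lookup \<equiv> Poly_Mapping.lookup"
abbreviation single where "single \<equiv> Poly_Mapping.single"

section \<open>Computing in free graded-commutative algebras\<close>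

lemma poly_mapping_as_sum_of_singles:
  fixes x :: "'a \<Rightarrow>\<^sub>0 'b::comm_monoid_add"
  shows "x = (\<Sum>a\<in>keys x. single a (lookup x a))"
  by (rule poly_mapping_eqI)
     (simp add: lookup_sum lookup_single when_def in_keys_iff)

lemma poly_mapping_additive_induct:
  fixes x :: "'a \<Rightarrow>\<^sub>0 'b::comm_monoid_add"
  assumes "\<And>a. a \<in> keys x \<Longrightarrow> P (single a (lookup x a))"
    and "P 0" and "\<And>y z. P y \<Longrightarrow> P z \<Longrightarrow> P (y + z)"
  shows "P x"
proof -
  have "P (\<Sum>a\<in>F. single a (lookup x a))" if "finite F" "F \<subseteq> keys x" for F
    using that by (induction rule: finite_induct) (auto intro: assms)
  from this[of "keys x"] show ?thesis
    using poly_mapping_as_sum_of_singles[of x] by simp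
qed

lemma smult_eq_mult: "Poly_Mapping.map ((*) c) x = single 0 c * x" for x :: gca
  by (rule mult_map_scale_conv_mult)

lemma keys_single_mult: "a \<in> keys (single u c * x) \<Longrightarrow> \<exists>b\<in>keys x. a = u + b"
  for x :: gca
  using keys_mult[of "single u c" x] by (auto split: if_splits)

text \<open>Enlarging the index sets beyond the supports puts the products of several elements over common
  index sets, where they can be added term by term.\<close>

lemma gca_mult_superset:
  assumes "finite K" "keys x \<subseteq> K" "finite L" "keys y \<subseteq> L"
  shows "gca_mult deg x y =
     (\<Sum>a\<in>K. \<Sum>b\<in>L. if admissible deg (a + b)
       then single (a + b) (koszul_sign deg a b * lookup x a * lookup y b) else 0)"
proof -
  let ?f = "\<lambda>a b. if admissible deg (a + b)
       then single (a + b) (koszul_sign deg a b * lookup x a * lookup y b) else 0"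
  have "(\<Sum>b\<in>keys y. ?f a b) = (\<Sum>b\<in>L. ?f a b)" for a
    by (rule sum.mono_neutral_left) (use assms in \<open>auto simp: in_keys_iff\<close>)
  moreover have "(\<Sum>a\<in>keys x. \<Sum>b\<in>L. ?f a b) = (\<Sum>a\<in>K. \<Sum>b\<in>L. ?f a b)"
    by (rule sum.mono_neutral_left) (use assms in \<open>auto simp: in_keys_iff intro!: sum.neutral\<close>)
  ultimately show ?thesis by (simp add: gca_mult_def)
qed

lemma gca_mult_zero [simp]: "gca_mult deg 0 y = 0" "gca_mult deg x 0 = 0"
  by (simp_all add: gca_mult_def)

lemma gca_mult_add_left: "gca_mult deg (x + x') y = gca_mult deg x y + gca_mult deg x' y"
proof -
  let ?K = "keys x \<union> keys x'" and ?L = "keys y"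
  have "keys (x + x') \<subseteq> ?K" by (rule Poly_Mapping.keys_add)
  then show ?thesis
    by (simp add: gca_mult_superset[of ?K _ ?L] sum.distrib[symmetric])
      (intro sum.cong refl; simp add: lookup_add distrib_left distrib_right single_add)
qed

lemma gca_mult_add_right: "gca_mult deg x (y + y') = gca_mult deg x y + gca_mult deg x y'"
proof -
  let ?K = "keys x" and ?L = "keys y \<union> keys y'"
  have "keys (y + y') \<subseteq> ?L" by (rule Poly_Mapping.keys_add)
  then show ?thesis
    by (simp add: gca_mult_superset[of ?K _ ?L] sum.distrib[symmetric])
      (intro sum.cong refl; simp add: lookup_add distrib_left distrib_right single_add)
qed

lemma keys_gca_mult:
  assumes "c \<in> keys (gca_mult deg x y)"
  obtains a b where "a \<in> keys x" "b \<in> keys y" "c = a + b" "admissible deg c"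
proof -
  let ?f = "\<lambda>a b. if admissible deg (a + b)
       then single (a + b) (koszul_sign deg a b * lookup x a * lookup y b) else 0"
  have "keys (gca_mult deg x y) \<subseteq> (\<Union>a\<in>keys x. keys (\<Sum>b\<in>keys y. ?f a b))"
    unfolding gca_mult_def by (rule Poly_Mapping.keys_sum)
  with assms obtain a where a: "a \<in> keys x" "c \<in> keys (\<Sum>b\<in>keys y. ?f a b)" by auto
  have "keys (\<Sum>b\<in>keys y. ?f a b) \<subseteq> (\<Union>b\<in>keys y. keys (?f a b))"
    by (rule Poly_Mapping.keys_sum)
  with a obtain b where "b \<in> keys y" "c \<in> keys (?f a b)" by blast
  with a that show ?thesis by (auto split: if_splits)
qed

lemma gca_mult_single_single:
  "gca_mult deg (single a c) (single b e) =
    (if admissible deg (a + b) then single (a + b) (koszul_sign deg a b * c * e) else 0)"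
  by (subst gca_mult_superset[of "{a}" _ "{b}"]) auto

lemma monomial_degree_superset:
  assumes "finite K" "keys a \<subseteq> K"
  shows "monomial_degree deg a = (\<Sum>i\<in>K. deg i * lookup a i)"
  unfolding monomial_degree_def
  by (rule sum.mono_neutral_left) (use assms in \<open>auto simp: in_keys_iff\<close>)

lemma keys_add_nat: "keys (a + b) = keys a \<union> keys b" for a b :: monomial
  by (auto simp: in_keys_iff lookup_add)

lemma monomial_degree_add [simp]:
  "monomial_degree deg (a + b) = monomial_degree deg a + monomial_degree deg b"
  by (simp add: monomial_degree_superset[of "keys a \<union> keys b"] keys_add_nat lookup_add
      distrib_left sum.distrib)

lemma monomial_degree_single [simp]: "monomial_degree deg (single i k) = deg i * k"
  by (simp add: monomial_degree_superset[of "{i}"])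

lemma monomial_degree_zero [simp]: "monomial_degree deg 0 = 0"
  by (simp add: monomial_degree_def)

text \<open>The generator split off is the first one, so that no Koszul sign appears.\<close>

lemma split_off_first_generator:
  assumes "admissible deg a" "a \<noteq> 0"
  obtains i b where "i \<in> keys a" "a = single i 1 + b"
    "\<And>c. single a c = gca_mult deg (gen i) (single b c)"
proof -
  define i where "i = Min (keys a)"
  have "keys a \<noteq> {}" using assms by simp
  then have i: "i \<in> keys a" "\<And>j. j \<in> keys a \<Longrightarrow> i \<le> j"
    unfolding i_def by auto
  define b where "b = a - single i 1"
  have lb: "lookup b j = lookup a j - (if j = i then 1 else 0)" for j
    by (simp add: b_def lookup_minus lookup_single when_def)
  have a: "a = single i 1 + b"
    by (rule poly_mapping_eqI) (use i in \<open>auto simp: lb lookup_add lookup_single when_def in_keys_iff\<close>)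
  have "keys b \<subseteq> keys a" by (auto simp: lb in_keys_iff split: if_splits)
  then have "koszul_sign deg (single i 1) b = 1"
    unfolding koszul_sign_def
    by (subst sum.neutral) (use i in \<open>force intro!: sum.neutral\<close>, simp)
  then have "single a c = gca_mult deg (gen i) (single b c)" for c
    using assms a by (simp add: gen_def gca_mult_single_single)
  with i a that show ?thesis by blast
qed

section \<open>Homogeneous parts\<close>

definition homogeneous_part :: "(nat \<Rightarrow> nat) \<Rightarrow> nat \<Rightarrow> gca \<Rightarrow> gca" where
  "homogeneous_part deg k x =
     (\<Sum>a\<in>{a \<in> keys x. monomial_degree deg a = k}. single a (lookup x a))"

lemma lookup_homogeneous_part:
  "lookup (homogeneous_part deg k x) a = (if monomial_degree deg a = k then lookup x a else 0)"
  by (auto simp: homogeneous_part_def lookup_sum lookup_single when_def in_keys_iff)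

lemma homogeneous_part_add:
  "homogeneous_part deg k (x + y) = homogeneous_part deg k x + homogeneous_part deg k y"
  by (rule poly_mapping_eqI) (simp add: lookup_homogeneous_part lookup_add)

lemma homogeneous_part_diff:
  "homogeneous_part deg k (x - y) = homogeneous_part deg k x - homogeneous_part deg k y"
  by (rule poly_mapping_eqI) (simp add: lookup_homogeneous_part lookup_minus)

lemma homogeneous_part_zero [simp]: "homogeneous_part deg k 0 = 0"
  by (rule poly_mapping_eqI) (simp add: lookup_homogeneous_part)

lemma homogeneous_part_sum:
  "homogeneous_part deg k (\<Sum>i\<in>S. f i) = (\<Sum>i\<in>S. homogeneous_part deg k (f i))"
  by (induction S rule: infinite_finite_induct) (simp_all add: homogeneous_part_add)

lemma keys_homogeneous_part:
  "keys (homogeneous_part deg k x) = {a \<in> keys x. monomial_degree deg a = k}"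
  by (auto simp: in_keys_iff lookup_homogeneous_part split: if_splits)

lemma homogeneous_part_in_component:
  "x \<in> carrier (free_gca I deg) \<Longrightarrow> homogeneous_part deg k x \<in> component (free_gca I deg) k"
  by (auto simp: free_gca_def keys_homogeneous_part)

lemma homogeneous_part_component:
  "x \<in> component (free_gca I deg) j \<Longrightarrow> homogeneous_part deg k x = (if k = j then x else 0)"
  by (rule poly_mapping_eqI) (auto simp: free_gca_def lookup_homogeneous_part in_keys_iff)

lemma single_in_component:
  "keys a \<subseteq> I \<Longrightarrow> admissible deg a \<Longrightarrow> single a c \<in> component (free_gca I deg) (monomial_degree deg a)"
  by (auto simp: free_gca_def split: if_splits)

lemma gen_in_component: "i \<in> I \<Longrightarrow> gen i \<in> component (free_gca I deg) (deg i)"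
proof -
  assume "i \<in> I"
  moreover have "admissible deg (single i 1)"
    by (auto simp: admissible_def lookup_single when_def)
  ultimately show ?thesis
    using single_in_component[of "single i 1" I deg 1] by (simp add: gen_def)
qed


section \<open>Extensions of an odd free algebra by a closed generator of degree two\<close>

locale odd_extension =
  fixes n :: nat and deg :: "nat \<Rightarrow> nat" and D :: "gca \<Rightarrow> gca"
  assumes deg_t: "deg 0 = 2"
    and odd_deg: "j \<in> {1..n} \<Longrightarrow> odd (deg j)"
    and deg_gt: "j \<in> {1..n} \<Longrightarrow> 1 < deg j"
    and differential: "is_differential (free_gca {0..n} deg) D"
    and D_t: "D (gen 0) = 0"
begin

abbreviation A where "A \<equiv> free_gca {0..n} deg"

abbreviation t_term :: "rat \<Rightarrow> nat \<Rightarrow> gca" where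
  "t_term c b \<equiv> single (single 0 b) c"

text \<open>The degree of the image of a monomial under \<open>t \<mapsto> 1\<close>.\<close>

definition fibre_degree :: "monomial \<Rightarrow> nat" where
  "fibre_degree a = (\<Sum>j\<in>{1..n}. deg j * lookup a j)"

text \<open>The degree of the product of all odd generators, hence the formal dimension of the fibre.\<close>

definition top_degree :: nat where
  "top_degree = (\<Sum>j\<in>{1..n}. deg j)"

lemma deg_ge_3: "j \<in> {1..n} \<Longrightarrow> 3 \<le> deg j"
  using odd_deg[of j] deg_gt[of j] by (cases "deg j = 2") auto

lemma monomial_degree_split:
  "keys a \<subseteq> {0..n} \<Longrightarrow> monomial_degree deg a = 2 * lookup a 0 + fibre_degree a"
proof -
  assume "keys a \<subseteq> {0..n}"
  moreover have "{0..n} = insert 0 {1..n}" by auto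
  ultimately show ?thesis
    by (simp add: monomial_degree_superset[of "{0..n}"] fibre_degree_def deg_t)
qed

lemma carrier_iff: "x \<in> carrier A \<longleftrightarrow> (\<forall>a\<in>keys x. keys a \<subseteq> {0..n} \<and> admissible deg a)"
  by (simp add: free_gca_def)

lemma component_iff:
  "x \<in> component A k \<longleftrightarrow> x \<in> carrier A \<and> (\<forall>a\<in>keys x. monomial_degree deg a = k)"
  by (auto simp: free_gca_def)

lemma component_in_carrier: "x \<in> component A k \<Longrightarrow> x \<in> carrier A"
  by (simp add: component_iff)

lemma exponent_le_1: "x \<in> carrier A \<Longrightarrow> a \<in> keys x \<Longrightarrow> j \<in> {1..n} \<Longrightarrow> lookup a j \<le> 1"
  using odd_deg by (auto simp: carrier_iff admissible_def)

lemma carrier_zero [simp]: "0 \<in> carrier A" and component_zero [simp]: "0 \<in> component A k"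
  by (simp_all add: free_gca_def)

lemma carrier_add: "x \<in> carrier A \<Longrightarrow> y \<in> carrier A \<Longrightarrow> x + y \<in> carrier A"
  using Poly_Mapping.keys_add[of x y] by (force simp: carrier_iff)

lemma component_add: "x \<in> component A k \<Longrightarrow> y \<in> component A k \<Longrightarrow> x + y \<in> component A k"
  using Poly_Mapping.keys_add[of x y] by (fastforce simp: free_gca_def)

lemma component_sum: "(\<And>i. i \<in> S \<Longrightarrow> f i \<in> component A k) \<Longrightarrow> (\<Sum>i\<in>S. f i) \<in> component A k"
  by (induction S rule: infinite_finite_induct) (auto intro: component_add)

lemma carrier_induct [consumes 1, case_names monomial zero add]:
  assumes "x \<in> carrier A"
    and "\<And>a c. keys a \<subseteq> {0..n} \<Longrightarrow> admissible deg a \<Longrightarrow> P (single a c)"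
    and "P 0" and "\<And>y z. y \<in> carrier A \<Longrightarrow> z \<in> carrier A \<Longrightarrow> P y \<Longrightarrow> P z \<Longrightarrow> P (y + z)"
  shows "P x"
proof -
  have "x \<in> carrier A \<and> P x"
  proof (rule poly_mapping_additive_induct[of x "\<lambda>x. x \<in> carrier A \<and> P x"])
    show "single a (lookup x a) \<in> carrier A \<and> P (single a (lookup x a))" if "a \<in> keys x" for a
      using that assms(1,2) by (auto simp: carrier_iff)
  qed (auto intro: assms carrier_add)
  then show ?thesis by simp
qed

lemma t_term_mult_component:
  assumes "x \<in> component A k" shows "t_term c b * x \<in> component A (2 * b + k)"
proof -
  have "keys a \<subseteq> {0..n} \<and> admissible deg a \<and> monomial_degree deg a = 2 * b + k"
    if "a \<in> keys (t_term c b * x)" for a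
  proof -
    from keys_single_mult[OF that] obtain a' where "a' \<in> keys x" "a = single 0 b + a'" by auto
    with assms show ?thesis
      by (auto simp: component_iff carrier_iff keys_add_nat admissible_def lookup_add
          lookup_single when_def deg_t)
  qed
  then show ?thesis by (simp add: component_iff carrier_iff)
qed

lemma t_term_mult_carrier:
  assumes "x \<in> carrier A" shows "t_term c b * x \<in> carrier A"
proof -
  have "keys a \<subseteq> {0..n} \<and> admissible deg a" if "a \<in> keys (t_term c b * x)" for a
  proof -
    from keys_single_mult[OF that] obtain a' where "a' \<in> keys x" "a = single 0 b + a'" by auto
    with assms show ?thesis
      by (auto simp: carrier_iff keys_add_nat admissible_def lookup_add
          lookup_single when_def deg_t)
  qed
  then show ?thesis by (simp add: carrier_iff)
qed

lemma t_term_in_component: "t_term c b \<in> component A (2 * b)"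
  using single_in_component[of "single 0 b" "{0..n}" deg c]
  by (auto simp: admissible_def deg_t lookup_single when_def)

lemma one_in_component: "1 \<in> component A 0"
  using t_term_in_component[where b = 0 and c = 1] by simp

lemma scalar_mult_carrier: "x \<in> carrier A \<Longrightarrow> single 0 c * x \<in> carrier A"
  using t_term_mult_carrier[where b = 0] by simp

lemma carrier_diff: "x \<in> carrier A \<Longrightarrow> y \<in> carrier A \<Longrightarrow> x - y \<in> carrier A"
  using Poly_Mapping.keys_diff[of x y] by (force simp: carrier_iff)

lemma component_diff: "x \<in> component A k \<Longrightarrow> y \<in> component A k \<Longrightarrow> x - y \<in> component A k"
  using Poly_Mapping.keys_diff[of x y] by (fastforce simp: free_gca_def)

lemma gca_mult_carrier:
  assumes "x \<in> carrier A" "y \<in> carrier A" shows "gca_mult deg x y \<in> carrier A"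
  unfolding carrier_iff
proof
  fix c assume "c \<in> keys (gca_mult deg x y)"
  then obtain a b where "a \<in> keys x" "b \<in> keys y" "c = a + b" "admissible deg c"
    by (rule keys_gca_mult)
  with assms show "keys c \<subseteq> {0..n} \<and> admissible deg c"
    by (auto simp: carrier_iff keys_add_nat)
qed

text \<open>The algebra is a module over \<open>\<rat>[t]\<close>, and there the commutative convolution product
  agrees with the product of the algebra. It makes the cancellation of powers of \<open>t\<close> available.\<close>

lemma gca_mult_t_term:
  assumes "y \<in> carrier A" shows "gca_mult deg (t_term c b) y = t_term c b * y"
  using assms
proof (induction rule: carrier_induct)
  case (monomial a e)
  then have "admissible deg (single 0 b + a)"
    by (auto simp: admissible_def lookup_add lookup_single when_def deg_t)
  moreover have "koszul_sign deg (single 0 b) a = 1"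
    by (auto simp: koszul_sign_def)
  ultimately show ?case by (simp add: gca_mult_single_single mult_single)
qed (simp_all add: gca_mult_add_right distrib_left)

lemma t_divides:
  assumes x: "x \<in> component A k" and s: "\<And>a. a \<in> keys x \<Longrightarrow> s \<le> lookup a 0"
  obtains y where "y \<in> component A (k - 2 * s)" "x = t_term 1 s * y"
proof -
  define y where "y = (\<Sum>a\<in>keys x. single (a - single 0 s) (lookup x a))"
  have a: "single 0 s + (a - single 0 s) = a" if "a \<in> keys x" for a
    by (rule poly_mapping_eqI)
       (use s[OF that] in \<open>auto simp: lookup_add lookup_minus lookup_single when_def\<close>)
  have "single (a - single 0 s) (lookup x a) \<in> component A (k - 2 * s)" if "a \<in> keys x" for a
  proof -
    have "keys (a - single 0 s) \<subseteq> keys a"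
      by (auto simp: in_keys_iff lookup_minus)
    then have "keys (a - single 0 s) \<subseteq> {0..n}"
      using x that by (auto simp: component_iff carrier_iff)
    moreover have "admissible deg (a - single 0 s)"
      using x that
      by (auto simp: component_iff carrier_iff lookup_minus admissible_def intro: le_trans[OF diff_le_self])
    moreover have "monomial_degree deg (a - single 0 s) = k - 2 * s"
      using arg_cong[OF a[OF that], of "monomial_degree deg"] x that
      by (simp add: component_iff deg_t)
    ultimately show ?thesis using single_in_component by metis
  qed
  then have "y \<in> component A (k - 2 * s)" unfolding y_def by (rule component_sum)
  moreover have "t_term 1 s * y = (\<Sum>a\<in>keys x. single a (lookup x a))"
    unfolding y_def by (simp add: sum_distrib_left mult_single a)
  then have "x = t_term 1 s * y" using poly_mapping_as_sum_of_singles[of x] by simp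
  ultimately show ?thesis by (rule that)
qed

lemma D_carrier: "x \<in> carrier A \<Longrightarrow> D x \<in> carrier A"
  and D_add: "x \<in> carrier A \<Longrightarrow> y \<in> carrier A \<Longrightarrow> D (x + y) = D x + D y"
  and D_component: "x \<in> component A k \<Longrightarrow> D x \<in> component A (Suc k)"
  and D_D: "x \<in> carrier A \<Longrightarrow> D (D x) = 0"
  and D_scalar: "x \<in> carrier A \<Longrightarrow> D (single 0 c * x) = single 0 c * D x"
  and D_leibniz: "x \<in> component A k \<Longrightarrow> y \<in> carrier A \<Longrightarrow>
        D (gca_mult deg x y) = gca_mult deg (D x) y + single 0 ((- 1) ^ k) * gca_mult deg x (D y)"
proof -
  have sel: "add A = (+)" "zero A = 0" "smult A = (\<lambda>c. Poly_Mapping.map ((*) c))" "mult A = gca_mult deg"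
    by (simp_all add: free_gca_def)
  note d = differential[unfolded is_differential_def sel smult_eq_mult]
  show "x \<in> carrier A \<Longrightarrow> D x \<in> carrier A"
    "x \<in> carrier A \<Longrightarrow> y \<in> carrier A \<Longrightarrow> D (x + y) = D x + D y"
    "x \<in> component A k \<Longrightarrow> D x \<in> component A (Suc k)"
    "x \<in> carrier A \<Longrightarrow> D (D x) = 0"
    "x \<in> carrier A \<Longrightarrow> D (single 0 c * x) = single 0 c * D x"
    "x \<in> component A k \<Longrightarrow> y \<in> carrier A \<Longrightarrow>
        D (gca_mult deg x y) = gca_mult deg (D x) y + single 0 ((- 1) ^ k) * gca_mult deg x (D y)"
    using d by blast+
qed

lemma D_zero [simp]: "D 0 = 0"
  using D_add[of 0 0] by simp

lemma D_diff: "x \<in> carrier A \<Longrightarrow> y \<in> carrier A \<Longrightarrow> D (x - y) = D x - D y"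
  using D_add[of "x - y" y] carrier_diff[of x y] by (simp add: algebra_simps)

lemma gen_t: "gen 0 = t_term 1 1"
  by (simp add: gen_def)

lemma D_t_mult: "x \<in> carrier A \<Longrightarrow> D (t_term 1 1 * x) = t_term 1 1 * D x"
proof -
  assume x: "x \<in> carrier A"
  have "D (gca_mult deg (t_term 1 1) x) = t_term 1 1 * D x"
    using D_leibniz[OF t_term_in_component[of 1 1] x] D_t x
    by (simp add: gen_t gca_mult_t_term D_carrier)
  with x show ?thesis by (simp add: gca_mult_t_term)
qed

lemma D_t_term_mult: "x \<in> carrier A \<Longrightarrow> D (t_term c b * x) = t_term c b * D x"
proof (induction b arbitrary: x)
  case 0
  then show ?case by (simp add: D_scalar)
next
  case (Suc b)
  have split: "t_term c (Suc b) = t_term c b * t_term 1 1"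
    by (simp add: mult_single single_add[symmetric])
  from Suc show ?case
    by (simp add: split mult.assoc t_term_mult_carrier D_t_mult[simplified])
qed

lemma t_cancel: "t_term c b * x = t_term c b * y \<Longrightarrow> c \<noteq> 0 \<Longrightarrow> x = y"
  by (simp add: Poly_Mapping.keys_eq_empty[symmetric] del: Poly_Mapping.keys_eq_empty)

lemma D_t_term: "D (t_term c b) = 0"
proof -
  have "t_term 1 1 * D 1 = 0"
    using D_t_mult[OF component_in_carrier[OF one_in_component]] D_t by (simp add: gen_t)
  then have "D 1 = 0" using t_cancel[of 1 1 "D 1" 0] by simp
  then show ?thesis
    using D_t_term_mult[OF component_in_carrier[OF one_in_component], where b = b and c = c] by simp
qed

lemma D_homogeneous_part:
  assumes "x \<in> carrier A"
  shows "D (homogeneous_part deg k x) = homogeneous_part deg (Suc k) (D x)"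
    and "homogeneous_part deg 0 (D x) = 0"
proof -
  have hp: "homogeneous_part deg k x \<in> carrier A" if "x \<in> carrier A" for k x
    using homogeneous_part_in_component[OF that] by (rule component_in_carrier)
  have "D (homogeneous_part deg k x) = homogeneous_part deg (Suc k) (D x)
      \<and> homogeneous_part deg 0 (D x) = 0"
    using assms
  proof (induction rule: carrier_induct)
    case (monomial a c)
    from single_in_component[OF this] have a: "single a c \<in> component A (monomial_degree deg a)" .
    then show ?case
      using homogeneous_part_component[OF D_component[OF a]] by (simp add: homogeneous_part_component)
  qed (simp_all add: homogeneous_part_add D_add hp)
  then show "D (homogeneous_part deg k x) = homogeneous_part deg (Suc k) (D x)"
    and "homogeneous_part deg 0 (D x) = 0" by simp_all
qed

text \<open>A homogeneous exact element has a homogeneous primitive; the latter is cut out of a given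
  primitive, so that bounds on the monomials of the given one survive.\<close>

lemma exact_component:
  assumes "x \<in> component A (Suc k)" "x = D w" "w \<in> carrier A"
  shows "\<exists>w'\<in>component A k. x = D w' \<and> keys w' \<subseteq> keys w"
proof
  let ?w = "homogeneous_part deg k w"
  show "?w \<in> component A k" using assms(3) by (rule homogeneous_part_in_component)
  have "x = homogeneous_part deg (Suc k) (D w)"
    using assms by (simp add: homogeneous_part_component)
  then show "x = D ?w \<and> keys ?w \<subseteq> keys w"
    using assms(3) by (simp add: D_homogeneous_part keys_homogeneous_part)
qed

text \<open>The ideal generated by the odd generators. An element of the algebra lies outside of it if
  and only if it contains a pure power of \<open>t\<close>.\<close>

definition fibre_ideal :: "gca set" where
  "fibre_ideal = {x. \<forall>a\<in>keys x. \<exists>j. j \<noteq> 0 \<and> lookup a j \<noteq> 0}"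

lemma fibre_ideal_add: "x \<in> fibre_ideal \<Longrightarrow> y \<in> fibre_ideal \<Longrightarrow> x + y \<in> fibre_ideal"
  using Poly_Mapping.keys_add[of x y] unfolding fibre_ideal_def by blast

lemma fibre_ideal_gca_mult:
  assumes "x \<in> fibre_ideal \<or> y \<in> fibre_ideal" shows "gca_mult deg x y \<in> fibre_ideal"
  unfolding fibre_ideal_def
proof (intro CollectI ballI)
  fix c assume "c \<in> keys (gca_mult deg x y)"
  then obtain a b where "a \<in> keys x" "b \<in> keys y" "c = a + b" by (rule keys_gca_mult)
  with assms obtain j where "j \<noteq> 0" "lookup a j \<noteq> 0 \<or> lookup b j \<noteq> 0"
    unfolding fibre_ideal_def by blast
  with \<open>c = a + b\<close> show "\<exists>j. j \<noteq> 0 \<and> lookup c j \<noteq> 0"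
    by (intro exI[of _ j]) (simp add: lookup_add)
qed

lemma fibre_ideal_t_term_mult: "x \<in> fibre_ideal \<Longrightarrow> t_term c b * x \<in> fibre_ideal"
  unfolding fibre_ideal_def
proof (intro CollectI ballI)
  fix a assume x: "x \<in> {x. \<forall>a\<in>keys x. \<exists>j. j \<noteq> 0 \<and> lookup a j \<noteq> 0}"
  assume "a \<in> keys (t_term c b * x)"
  then obtain a' where "a' \<in> keys x" "a = single 0 b + a'" using keys_single_mult by blast
  with x obtain j where "j \<noteq> 0" "lookup a' j \<noteq> 0" by blast
  with \<open>a = single 0 b + a'\<close> show "\<exists>j. j \<noteq> 0 \<and> lookup a j \<noteq> 0"
    by (intro exI[of _ j]) (simp add: lookup_add)
qed

text \<open>By the Leibniz rule, each term in the differential of a monomial contains the differential of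
  a single generator as a factor; if these all lie in the ideal, so does the sum.\<close>

lemma D_into_fibre_ideal:
  assumes "\<And>j. j \<in> {1..n} \<Longrightarrow> D (gen j) \<in> fibre_ideal" and "x \<in> carrier A"
  shows "D x \<in> fibre_ideal"
proof -
  have mono: "D (single a c) \<in> fibre_ideal" if "keys a \<subseteq> {0..n}" "admissible deg a" for a c
    using that
  proof (induction "monomial_degree deg a" arbitrary: a rule: less_induct)
    case less
    show ?case
    proof (cases "a = 0")
      case True
      then show ?thesis using D_t_term[of 0 c] by (simp add: fibre_ideal_def)
    next
      case False
      obtain i b where i: "i \<in> keys a" "a = single i 1 + b"
        "\<And>c. single a c = gca_mult deg (gen i) (single b c)"
        using split_off_first_generator[OF less.prems(2) False] by blast
      have b: "keys b \<subseteq> {0..n}" "admissible deg b"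
        using less.prems i(2) by (auto simp: keys_add_nat admissible_def lookup_add dest: add_leD2)
      have in_A: "gen i \<in> component A (deg i)" "single b c \<in> carrier A"
        using i(1) less.prems(1) b gen_in_component
          component_in_carrier[OF single_in_component] by blast+
      have "0 < deg i" using i(1) less.prems(1) deg_t deg_gt[of i] by (cases "i = 0") force+
      then have "D (single b c) \<in> fibre_ideal" using b i(2) by (intro less.hyps) simp_all
      moreover have "D (gen i) \<in> fibre_ideal"
        using i(1) less.prems(1) assms(1)[of i] D_t by (cases "i = 0") (auto simp: fibre_ideal_def)
      ultimately have "gca_mult deg (D (gen i)) (single b c) +
          t_term ((- 1) ^ deg i) 0 * gca_mult deg (gen i) (D (single b c)) \<in> fibre_ideal"
        by (intro fibre_ideal_add fibre_ideal_t_term_mult fibre_ideal_gca_mult) simp_all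
      then show ?thesis using D_leibniz[OF in_A] i(3) by simp
    qed
  qed
  show ?thesis
    using assms(2)
  proof (induction rule: carrier_induct)
    case zero show ?case by (simp add: fibre_ideal_def)
  qed (simp_all add: mono D_add fibre_ideal_add)
qed

lemma generator_hits_t_power:
  assumes "z \<in> carrier A" "D z = t_term c E" "c \<noteq> 0"
  obtains l e where "l \<in> {1..n}" "single 0 e \<in> keys (D (gen l))"
proof -
  have "D z \<notin> fibre_ideal"
    unfolding assms(2) using assms(3) by (simp add: fibre_ideal_def lookup_single when_def)
  then obtain l where l: "l \<in> {1..n}" "D (gen l) \<notin> fibre_ideal"
    using D_into_fibre_ideal[OF _ assms(1)] by metis
  then obtain a where a: "a \<in> keys (D (gen l))" "\<forall>j. j = 0 \<or> lookup a j = 0"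
    unfolding fibre_ideal_def by blast
  then have "a = single 0 (lookup a 0)"
    by (intro poly_mapping_eqI) (metis lookup_single_eq lookup_single_not_eq)
  with l a that show ?thesis by metis
qed

text \<open>A missing odd generator costs at least three degrees. This gap is what makes degree
  counts conclusive below.\<close>

lemma fibre_degree_not_top:
  assumes "x \<in> carrier A" "a \<in> keys x" "j \<in> {1..n}" "lookup a j \<noteq> 1"
  shows "fibre_degree a + 3 \<le> top_degree"
proof -
  have le: "lookup a i \<le> 1" if "i \<in> {1..n}" for i
    using exponent_le_1 assms that by blast
  have "lookup a j = 0" using le[OF assms(3)] assms(4) by linarith
  then have "fibre_degree a = (\<Sum>i\<in>{1..n} - {j}. deg i * lookup a i)"
    using sum.remove[of "{1..n}" j "\<lambda>i. deg i * lookup a i"] assms(3)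
    by (simp add: fibre_degree_def)
  also have "\<dots> \<le> (\<Sum>i\<in>{1..n} - {j}. deg i)"
    using le by (intro sum_mono) (metis DiffD1 mult_le_mono2 mult_1_right)
  finally have "fibre_degree a + deg j \<le> top_degree"
    using sum.remove[of "{1..n}" j deg] assms(3) by (simp add: top_degree_def)
  with deg_ge_3[OF assms(3)] show ?thesis by linarith
qed

lemma fibre_degree_le_top:
  assumes "x \<in> carrier A" "a \<in> keys x" shows "fibre_degree a \<le> top_degree"
proof (cases "\<forall>j\<in>{1..n}. lookup a j = 1")
  case True
  then show ?thesis by (simp add: fibre_degree_def top_degree_def)
next
  case False
  then show ?thesis using fibre_degree_not_top assms by fastforce
qed

section \<open>Cohomology classes\<close>

abbreviation H where "H \<equiv> cohomology A D"
abbreviation B where "B \<equiv> coboundaries A D"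

text \<open>The coset of the coboundaries, but in terms of the addition of the underlying type.\<close>

definition cohomology_class :: "gca \<Rightarrow> gca set" where
  "cohomology_class x = (\<lambda>b. b + x) ` B"

lemma r_coset_eq_cohomology_class:
  "B +>\<^bsub>A\<^esub> x = cohomology_class x" "B +>\<^bsub>A\<lparr>carrier := Z\<rparr>\<^esub> x = cohomology_class x"
  "B #>\<^bsub>add_monoid (A\<lparr>carrier := Z\<rparr>)\<^esub> x = cohomology_class x"
  by (auto simp: cohomology_class_def a_r_coset_def r_coset_def free_gca_def)

lemma B_I: "w \<in> carrier A \<Longrightarrow> D w \<in> B"
  by (simp add: coboundaries_def)

lemma B_zero: "0 \<in> B"
  using B_I[of 0] by simp

lemma B_add: "x \<in> B \<Longrightarrow> y \<in> B \<Longrightarrow> x + y \<in> B"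
  by (auto simp: coboundaries_def D_add[symmetric] carrier_add)

lemma B_diff: "x \<in> B \<Longrightarrow> y \<in> B \<Longrightarrow> x - y \<in> B"
  by (auto simp: coboundaries_def D_diff[symmetric] carrier_diff)

lemma B_t_term_mult: "x \<in> B \<Longrightarrow> t_term c b * x \<in> B"
  by (auto simp: coboundaries_def D_t_term_mult[symmetric] t_term_mult_carrier)

lemma cocycles_iff: "x \<in> cocycles A D \<longleftrightarrow> x \<in> carrier A \<and> D x = 0"
  by (auto simp: cocycles_def free_gca_def)

lemma B_cocycle: "x \<in> B \<Longrightarrow> x \<in> cocycles A D"
  by (auto simp: coboundaries_def cocycles_iff D_carrier D_D)

lemma mem_cohomology_class: "z \<in> cohomology_class x \<longleftrightarrow> z - x \<in> B"
  by (auto simp: cohomology_class_def image_iff) (metis diff_add_cancel)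

lemma cohomology_class_eq_iff: "cohomology_class x = cohomology_class y \<longleftrightarrow> x - y \<in> B"
proof
  assume "cohomology_class x = cohomology_class y"
  then have "x \<in> cohomology_class y" using mem_cohomology_class[of x x] B_zero by simp
  then show "x - y \<in> B" by (simp add: mem_cohomology_class)
next
  assume "x - y \<in> B"
  then show "cohomology_class x = cohomology_class y"
    using B_add[of _ "x - y"] B_diff[of _ "x - y"] by (force simp: mem_cohomology_class)
qed

lemma carrier_H: "carrier H = cohomology_class ` cocycles A D"
  unfolding cohomology_def cohomology_ring_def FactRing_def A_RCOSETS_def RCOSETS_def
    r_coset_eq_cohomology_class by auto

lemma component_H: "component H k = cohomology_class ` (cocycles A D \<inter> component A k)"
  by (simp add: cohomology_def r_coset_eq_cohomology_class)

lemma zero_H: "\<zero>\<^bsub>H\<^esub> = cohomology_class 0"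
  by (simp add: cohomology_def cohomology_ring_def FactRing_def cohomology_class_def)

lemma one_H: "\<one>\<^bsub>H\<^esub> = cohomology_class 1"
  by (simp add: cohomology_def cohomology_ring_def FactRing_def r_coset_eq_cohomology_class)
     (simp add: free_gca_def)

lemma add_H: "cohomology_class x \<oplus>\<^bsub>H\<^esub> cohomology_class y = cohomology_class (x + y)"
proof -
  have "cohomology_class x \<oplus>\<^bsub>H\<^esub> cohomology_class y = (\<Union>h\<in>cohomology_class x. \<Union>k\<in>cohomology_class y. {h + k})"
    by (simp add: cohomology_def cohomology_ring_def FactRing_def set_add_def' free_gca_def)
  also have "\<dots> = cohomology_class (x + y)"
  proof (intro equalityI subsetI)
    fix z assume "z \<in> (\<Union>h\<in>cohomology_class x. \<Union>k\<in>cohomology_class y. {h + k})"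
    then obtain b b' where "b \<in> B" "b' \<in> B" "z = (b + x) + (b' + y)" by (auto simp: cohomology_class_def)
    then show "z \<in> cohomology_class (x + y)" using B_add[of b b'] by (simp add: mem_cohomology_class algebra_simps)
  next
    fix z assume "z \<in> cohomology_class (x + y)"
    then have "(z - y) - x \<in> B" by (simp add: mem_cohomology_class algebra_simps)
    then have "z - y \<in> cohomology_class x" "y \<in> cohomology_class y" "z = (z - y) + y"
      using B_zero by (simp_all add: mem_cohomology_class)
    then show "z \<in> (\<Union>h\<in>cohomology_class x. \<Union>k\<in>cohomology_class y. {h + k})" by blast
  qed
  finally show ?thesis .
qed

lemma smult_H: "c \<odot>\<^bsub>H\<^esub> cohomology_class x = cohomology_class (single 0 c * x)"
proof -
  have eq: "cohomology_class (single 0 c * x') = cohomology_class (single 0 c * x)" if "x' \<in> cohomology_class x" for x'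
    using that B_t_term_mult[of "x' - x" 0 c]
    by (simp add: mem_cohomology_class cohomology_class_eq_iff right_diff_distrib)
  have "c \<odot>\<^bsub>H\<^esub> cohomology_class x = (\<Union>x'\<in>cohomology_class x. cohomology_class (single 0 c * x'))"
    by (simp add: cohomology_def r_coset_eq_cohomology_class) (simp add: free_gca_def smult_eq_mult)
  moreover have "x \<in> cohomology_class x" by (simp add: mem_cohomology_class B_zero)
  ultimately show ?thesis using eq by blast
qed

lemma B_gca_mult_right:
  assumes "b \<in> B" "v \<in> cocycles A D" shows "gca_mult deg b v \<in> B"
proof -
  from assms obtain z where z: "z \<in> carrier A" "b = D z" by (auto simp: coboundaries_def)
  from z(1) have "gca_mult deg (D z) v \<in> B"
  proof (induction rule: carrier_induct)
    case (monomial a c)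
    from single_in_component[OF this] have a: "single a c \<in> component A (monomial_degree deg a)" .
    from D_leibniz[OF a, of v] assms(2)
    have "gca_mult deg (D (single a c)) v = D (gca_mult deg (single a c) v)"
      by (simp add: cocycles_iff)
    then show ?case
      using B_I gca_mult_carrier[OF component_in_carrier[OF a]] assms(2) by (simp add: cocycles_iff)
  qed (simp_all add: B_zero gca_mult_add_left D_add B_add)
  with z show ?thesis by simp
qed

text \<open>The factor \<open>x\<close> has to be homogeneous, for otherwise there is no single sign in the Leibniz
  rule.\<close>

lemma B_gca_mult_left:
  assumes "x \<in> cocycles A D \<inter> component A k" "b \<in> B" shows "gca_mult deg x b \<in> B"
proof -
  from assms obtain w where w: "w \<in> carrier A" "b = D w" by (auto simp: coboundaries_def)
  let ?s = "single 0 ((- 1) ^ k) :: gca"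
  have "?s * ?s = 1"
    by (simp add: mult_single power_mult_distrib[symmetric])
  moreover have "D (gca_mult deg x w) = ?s * gca_mult deg x b"
    using assms w D_leibniz[of x k w] by (simp add: cocycles_iff)
  ultimately have "gca_mult deg x b = ?s * D (gca_mult deg x w)"
    by (simp add: mult.assoc[symmetric])
  moreover have "D (gca_mult deg x w) \<in> B"
    using assms w by (intro B_I gca_mult_carrier) (auto simp: cocycles_iff)
  ultimately show ?thesis using B_t_term_mult[where b = 0] by simp
qed

lemma mult_H:
  assumes x: "x \<in> cocycles A D \<inter> component A k" and y: "y \<in> cocycles A D"
  shows "cohomology_class x \<otimes>\<^bsub>H\<^esub> cohomology_class y = cohomology_class (gca_mult deg x y)"
proof -
  have "cohomology_class (gca_mult deg x' y') = cohomology_class (gca_mult deg x y)"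
    if "x' \<in> cohomology_class x" "y' \<in> cohomology_class y" for x' y'
  proof -
    define b b' where "b = x' - x" and "b' = y' - y"
    have b: "b \<in> B" "b' \<in> B" "x' = b + x" "y' = b' + y"
      using that by (simp_all add: b_def b'_def mem_cohomology_class)
    have "y' \<in> cocycles A D"
      using B_cocycle[OF b(2)] y unfolding b(4) by (simp add: cocycles_iff D_add carrier_add)
    then have "gca_mult deg b y' + gca_mult deg x b' \<in> B"
      using B_gca_mult_right[OF b(1)] B_gca_mult_left[OF x b(2)] B_add by blast
    moreover have "gca_mult deg x' y' - gca_mult deg x y = gca_mult deg b y' + gca_mult deg x b'"
      unfolding b(3) gca_mult_add_left by (simp add: b(4) gca_mult_add_right)
    ultimately show ?thesis by (simp add: cohomology_class_eq_iff)
  qed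
  moreover have "cohomology_class x \<otimes>\<^bsub>H\<^esub> cohomology_class y =
      (\<Union>x'\<in>cohomology_class x. \<Union>y'\<in>cohomology_class y. cohomology_class (gca_mult deg x' y'))"
    by (simp add: cohomology_def cohomology_ring_def FactRing_def rcoset_mult_def
        r_coset_eq_cohomology_class) (simp add: free_gca_def)
  moreover have "x \<in> cohomology_class x" "y \<in> cohomology_class y" by (simp_all add: mem_cohomology_class B_zero)
  ultimately show ?thesis by blast
qed

lemma component_H_trivial_iff:
  "component H k = {\<zero>\<^bsub>H\<^esub>} \<longleftrightarrow> (\<forall>x\<in>component A k. D x = 0 \<longrightarrow> x \<in> B)"
proof -
  have "component H k = {\<zero>\<^bsub>H\<^esub>} \<longleftrightarrow> (\<forall>x\<in>cocycles A D \<inter> component A k. cohomology_class x = cohomology_class 0)"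
    using B_cocycle[OF B_zero] component_zero[of k] unfolding component_H zero_H by blast
  then show ?thesis by (auto simp: cohomology_class_eq_iff cocycles_iff component_in_carrier)
qed

lemma abelian_monoid_H: "abelian_monoid H"
proof (rule abelian_monoidI)
  have cyc: "x + y \<in> cocycles A D" if "x \<in> cocycles A D" "y \<in> cocycles A D" for x y
    using that by (simp add: cocycles_iff carrier_add D_add)
  show "x \<oplus>\<^bsub>H\<^esub> y \<in> carrier H" if "x \<in> carrier H" "y \<in> carrier H" for x y
    using that cyc by (auto simp: carrier_H add_H)
  show "\<zero>\<^bsub>H\<^esub> \<in> carrier H"
    using B_cocycle[OF B_zero] by (auto simp: carrier_H zero_H)
qed (auto simp: carrier_H zero_H add_H ac_simps)

lemma finsum_H:
  assumes "finite S" "\<And>s. s \<in> S \<Longrightarrow> f s \<in> cocycles A D"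
  shows "(\<Oplus>\<^bsub>H\<^esub>s\<in>S. cohomology_class (f s)) = cohomology_class (\<Sum>s\<in>S. f s)"
  using assms
proof (induction S rule: finite_induct)
  case empty
  then show ?case by (simp add: abelian_monoid.finsum_empty[OF abelian_monoid_H] zero_H)
next
  case (insert s S)
  then have "(\<lambda>s. cohomology_class (f s)) \<in> S \<rightarrow> carrier H" "cohomology_class (f s) \<in> carrier H"
    by (auto simp: carrier_H)
  with insert show ?case
    by (simp add: abelian_monoid.finsum_insert[OF abelian_monoid_H] add_H)
qed

lemma B_homogeneous_part: "x \<in> B \<Longrightarrow> homogeneous_part deg k x \<in> B"
proof -
  assume "x \<in> B"
  then obtain w where w: "w \<in> carrier A" "x = D w" by (auto simp: coboundaries_def)
  show ?thesis
  proof (cases k)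
    case 0
    with w show ?thesis using D_homogeneous_part(2)[OF w(1)] B_zero by simp
  next
    case (Suc k')
    with w show ?thesis
      using D_homogeneous_part(1)[OF w(1), of k'] B_I[of "homogeneous_part deg k' w"]
        component_in_carrier[OF homogeneous_part_in_component[OF w(1)]] by simp
  qed
qed

text \<open>Representatives of the finitely many spanning classes involve only finitely many degrees.
  In any other degree, taking homogeneous parts turns a linear relation between classes into
  exactness.\<close>

lemma finitely_many_nonzero_degrees:
  assumes "finite_dimensional H"
  shows "finite {k. component H k \<noteq> {\<zero>\<^bsub>H\<^esub>}}"
proof -
  obtain S where S': "finite S \<and> S \<subseteq> carrier H \<and>
      (\<forall>x\<in>carrier H. \<exists>c. x = (\<Oplus>\<^bsub>H\<^esub>s\<in>S. c s \<odot>\<^bsub>H\<^esub> s))"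
    using assms unfolding finite_dimensional_def by (elim exE)
  then have S: "finite S" "S \<subseteq> carrier H" by simp_all
  note span = S'[THEN conjunct2, THEN conjunct2, rule_format]
  have "\<forall>s\<in>S. \<exists>z. z \<in> cocycles A D \<and> s = cohomology_class z"
    using S(2) by (auto simp: carrier_H)
  then obtain z where z: "\<And>s. s \<in> S \<Longrightarrow> z s \<in> cocycles A D \<and> s = cohomology_class (z s)"
    by metis
  define K where "K = (\<Union>s\<in>S. monomial_degree deg ` keys (z s))"
  have "component H k = {\<zero>\<^bsub>H\<^esub>}" if k: "k \<notin> K" for k
    unfolding component_H_trivial_iff
  proof (intro ballI impI)
    fix x assume x: "x \<in> component A k" "D x = 0"
    then have "cohomology_class x \<in> carrier H"
      by (auto simp: carrier_H cocycles_iff component_in_carrier)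
    then obtain c where c: "cohomology_class x = (\<Oplus>\<^bsub>H\<^esub>s\<in>S. c s \<odot>\<^bsub>H\<^esub> s)" using span by blast
    have cz: "single 0 (c s) * z s \<in> cocycles A D" if "s \<in> S" for s
      using z[OF that] by (simp add: cocycles_iff scalar_mult_carrier D_scalar)
    have "c s \<odot>\<^bsub>H\<^esub> s = cohomology_class (single 0 (c s) * z s)" if "s \<in> S" for s
      using z[OF that] smult_H[of "c s" "z s"] by simp
    moreover have "cohomology_class (single 0 (c s) * z s) \<in> carrier H" if "s \<in> S" for s
      using cz[OF that] by (simp add: carrier_H)
    ultimately have "cohomology_class x = (\<Oplus>\<^bsub>H\<^esub>s\<in>S. cohomology_class (single 0 (c s) * z s))"
      unfolding c by (intro abelian_monoid.finsum_cong'[OF abelian_monoid_H]) auto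
    also have "\<dots> = cohomology_class (\<Sum>s\<in>S. single 0 (c s) * z s)"
      using S(1) cz by (rule finsum_H)
    finally have "x - (\<Sum>s\<in>S. single 0 (c s) * z s) \<in> B"
      by (simp add: cohomology_class_eq_iff)
    from B_homogeneous_part[OF this, of k]
    have "x - (\<Sum>s\<in>S. homogeneous_part deg k (single 0 (c s) * z s)) \<in> B"
      using x(1) by (simp add: homogeneous_part_diff homogeneous_part_sum homogeneous_part_component)
    moreover have "homogeneous_part deg k (single 0 (c s) * z s) = 0" if "s \<in> S" for s
    proof -
      have "keys (single 0 (c s) * z s) \<subseteq> keys (z s)"
        by (auto dest: keys_single_mult)
      then have "keys (homogeneous_part deg k (single 0 (c s) * z s)) = {}"
        using that k by (auto simp: keys_homogeneous_part K_def)
      then show ?thesis by simp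
    qed
    ultimately show "x \<in> B" by simp
  qed
  then have "{k. component H k \<noteq> {\<zero>\<^bsub>H\<^esub>}} \<subseteq> K" by blast
  moreover have "finite K" using S(1) by (simp add: K_def)
  ultimately show ?thesis by (rule finite_subset)
qed

section \<open>The symplectic class and the formal dimension\<close>

text \<open>The odd generators have degree at least three, so \<open>t\<close> is the only monomial of degree two.\<close>

lemma component_two_multiple_of_t:
  assumes x: "x \<in> component A 2" shows "x = t_term (lookup x (single 0 1)) 1"
proof -
  have "a = single 0 1" if a: "a \<in> keys x" for a
  proof -
    have sub: "keys a \<subseteq> {0..n}" and deg_a: "2 * lookup a 0 + fibre_degree a = 2"
      using x a monomial_degree_split[of a] by (auto simp: component_iff carrier_iff)
    have 0: "lookup a j = 0" if j: "j \<in> {1..n}" for j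
    proof (rule ccontr)
      assume "lookup a j \<noteq> 0"
      then have "deg j \<le> deg j * lookup a j" by simp
      also have "\<dots> \<le> fibre_degree a"
        unfolding fibre_degree_def using j by (intro member_le_sum) auto
      finally show False using deg_ge_3[OF j] deg_a by linarith
    qed
    then have "lookup a 0 = 1" using deg_a by (simp add: fibre_degree_def)
    moreover have "lookup a j = 0" if "j \<noteq> 0" for j
      using sub 0[of j] that by (cases "j \<in> {1..n}") (force simp: in_keys_iff)+
    ultimately show ?thesis
      by (intro poly_mapping_eqI) (metis lookup_single_eq lookup_single_not_eq)
  qed
  then show ?thesis
    by (intro poly_mapping_eqI) (metis in_keys_iff lookup_single_eq lookup_single_not_eq)
qed

lemma cohomology_class_t_power:
  "cohomology_class (t_term c 1) [^]\<^bsub>H\<^esub> (k::nat) = cohomology_class (t_term (c ^ k) k)"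
proof (induction k)
  case 0
  then show ?case by (simp add: nat_pow_def one_H)
next
  case (Suc k)
  have "cohomology_class (t_term c 1) [^]\<^bsub>H\<^esub> Suc k = cohomology_class (t_term (c ^ k) k) \<otimes>\<^bsub>H\<^esub> cohomology_class (t_term c 1)"
    using Suc by (simp add: nat_pow_def)
  also have "\<dots> = cohomology_class (gca_mult deg (t_term (c ^ k) k) (t_term c 1))"
    using t_term_in_component D_t_term
    by (intro mult_H[of _ "2 * k"]) (auto simp: cocycles_iff component_in_carrier[OF t_term_in_component])
  also have "gca_mult deg (t_term (c ^ k) k) (t_term c 1) = t_term (c ^ Suc k) (Suc k)"
    by (simp add: gca_mult_t_term component_in_carrier[OF t_term_in_component] mult_single
        single_add[symmetric] mult.commute)
  finally show ?case .
qed

lemma c_symplectic_t_power_not_exact: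
  assumes "c_symplectic H"
  obtains m where "formal_dimension H = 2 * m" "t_term 1 m \<notin> B"
proof -
  obtain m \<omega> where m: "formal_dimension H = 2 * m"
    and \<omega>: "\<omega> \<in> component H 2" "\<omega> [^]\<^bsub>H\<^esub> m \<noteq> \<zero>\<^bsub>H\<^esub>"
    using assms unfolding c_symplectic_def by blast
  obtain x where x: "x \<in> component A 2" "\<omega> = cohomology_class x"
    using \<omega>(1) by (auto simp: component_H)
  obtain c where c: "x = t_term c 1" using component_two_multiple_of_t[OF x(1)] by blast
  have "t_term 1 m \<notin> B"
  proof
    assume "t_term 1 m \<in> B"
    from B_t_term_mult[OF this, of 0 "c ^ m"] have "t_term (c ^ m) m \<in> B"
      by (simp add: mult_single)
    then have "\<omega> [^]\<^bsub>H\<^esub> m = \<zero>\<^bsub>H\<^esub>"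
      unfolding x(2) c cohomology_class_t_power zero_H cohomology_class_eq_iff by simp
    with \<omega>(2) show False by simp
  qed
  with m that show ?thesis by blast
qed

text \<open>A power of \<open>t\<close> is a cocycle, and in a degree without cohomology it is exact.\<close>

lemma t_nilpotent_in_cohomology:
  assumes "finite_dimensional H"
  obtains z k E where "z \<in> component A k" "Suc k = 2 * E" "D z = t_term 1 E"
proof -
  obtain b where b: "\<forall>k\<in>{k. component H k \<noteq> {\<zero>\<^bsub>H\<^esub>}}. k \<le> b"
    using finitely_many_nonzero_degrees[OF assms] finite_nat_set_iff_bounded_le by blast
  define E where "E = Suc b"
  have "\<not> 2 * E \<le> b" by (simp add: E_def)
  then have "component H (2 * E) = {\<zero>\<^bsub>H\<^esub>}" using b by blast
  then have "t_term 1 E \<in> B"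
    using t_term_in_component D_t_term unfolding component_H_trivial_iff by blast
  then obtain w where w: "w \<in> carrier A" "t_term 1 E = D w" by (auto simp: coboundaries_def)
  have E: "Suc (2 * E - 1) = 2 * E" by (simp add: E_def)
  have "t_term 1 E \<in> component A (Suc (2 * E - 1))"
    unfolding E by (rule t_term_in_component)
  from exact_component[OF this w(2,1)]
  obtain z where "z \<in> component A (2 * E - 1)" "D z = t_term 1 E" by metis
  with E that show ?thesis by blast
qed

text \<open>
  The part of the Gysin sequence around \<open>H\<^sup>N(A) \<rightarrow> H\<^sup>N(fibre) \<rightarrow> H\<^sup>N\<^sup>-\<^sup>1(A)\<close>, written out for the
  product \<open>\<tau>\<close> of all odd generators. For degree reasons \<open>D \<tau> = t y\<close>. If \<open>H\<^sup>N\<^sup>-\<^sup>1(A) = 0\<close>, then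
  \<open>y = D w\<close>, and \<open>\<tau> - t w\<close> is a cocycle. If also \<open>H\<^sup>N(A) = 0\<close>, then \<open>\<tau> - t w = D v\<close> with \<open>v\<close> of
  degree \<open>N - 1\<close>. No product of odd generators has this degree, so \<open>t\<close> divides \<open>v\<close>; then \<open>t\<close>
  divides \<open>\<tau>\<close>, which is absurd.
\<close>

lemma nonzero_cohomology_near_top_degree:
  assumes "1 \<le> n"
  shows "component H top_degree \<noteq> {\<zero>\<^bsub>H\<^esub>} \<or> component H (top_degree - 1) \<noteq> {\<zero>\<^bsub>H\<^esub>}"
proof (rule ccontr)
  assume "\<not> ?thesis"
  then have triv: "\<And>x. x \<in> component A top_degree \<Longrightarrow> D x = 0 \<Longrightarrow> x \<in> B"
    "\<And>x. x \<in> component A (top_degree - 1) \<Longrightarrow> D x = 0 \<Longrightarrow> x \<in> B"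
    by (simp_all add: component_H_trivial_iff)
  have "deg 1 \<le> top_degree"
    unfolding top_degree_def using assms by (intro member_le_sum) auto
  with deg_ge_3[of 1] assms have N3: "3 \<le> top_degree" by simp
  define top where "top = (\<Sum>j\<in>{1..n}. single j (1::nat))"
  have lookup_top: "lookup top j = (if j \<in> {1..n} then 1 else 0)" for j
    by (auto simp: top_def lookup_sum lookup_single when_def)
  then have top: "keys top \<subseteq> {0..n}" "admissible deg top"
    by (auto simp: in_keys_iff admissible_def split: if_splits)
  have "monomial_degree deg top = top_degree"
    using monomial_degree_split[OF top(1)] by (simp add: lookup_top fibre_degree_def top_degree_def)
  then have \<tau>: "single top 1 \<in> component A top_degree"
    using single_in_component[OF top, of 1] by simp
  \<comment> \<open>The degree of \<open>D \<tau>\<close> exceeds that of every product of odd generators.\<close>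
  have t_divides_D: "1 \<le> lookup a 0" if "a \<in> keys (D (single top 1))" for a
  proof -
    have a: "a \<in> keys (D (single top 1))" "D (single top 1) \<in> component A (Suc top_degree)"
      using that D_component[OF \<tau>] by simp_all
    then have "fibre_degree a \<le> top_degree" "2 * lookup a 0 + fibre_degree a = Suc top_degree"
      using fibre_degree_le_top monomial_degree_split[of a]
      by (auto simp: component_iff carrier_iff)
    then show ?thesis by linarith
  qed
  obtain y where y: "y \<in> component A (Suc top_degree - 2 * 1)" "D (single top 1) = t_term 1 1 * y"
    using t_divides[OF D_component[OF \<tau>], of 1] t_divides_D by blast
  have "t_term 1 1 * D y = 0"
    using D_t_term_mult[OF component_in_carrier[OF y(1)], of 1 1] y(2) D_D[of "single top 1"]
      component_in_carrier[OF \<tau>] by simp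
  then have "D y = 0" using t_cancel[of 1 1 "D y" 0] by simp
  then have "y \<in> B" using triv(2) y(1) N3 by simp
  then obtain w0 where w0: "w0 \<in> carrier A" "y = D w0" by (auto simp: coboundaries_def)
  have "y \<in> component A (Suc (top_degree - 2))"
    using y(1) N3 by (simp add: Suc_diff_le numeral_2_eq_2 Suc_diff_Suc)
  from exact_component[OF this w0(2,1)] obtain w where w: "w \<in> component A (top_degree - 2)" "y = D w"
    by blast
  have tw: "t_term 1 1 * w \<in> component A top_degree"
  proof -
    have "2 * 1 + (top_degree - 2) = top_degree" using N3 by linarith
    then show ?thesis using t_term_mult_component[OF w(1), of 1 1] by metis
  qed
  have "D (single top 1 - t_term 1 1 * w) = 0"
    using D_diff component_in_carrier[OF \<tau>] component_in_carrier[OF tw] y(2) w(2)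
      D_t_term_mult[OF component_in_carrier[OF w(1)]] by simp
  then have "single top 1 - t_term 1 1 * w \<in> B"
    using triv(1) component_diff[OF \<tau> tw] by blast
  then obtain v0 where v0: "v0 \<in> carrier A" "single top 1 - t_term 1 1 * w = D v0"
    by (auto simp: coboundaries_def)
  have "single top 1 - t_term 1 1 * w \<in> component A (Suc (top_degree - 1))"
    using component_diff[OF \<tau> tw] N3 by simp
  from exact_component[OF this v0(2,1)]
  obtain v where v: "v \<in> component A (top_degree - 1)" "single top 1 - t_term 1 1 * w = D v"
    by blast
  have "1 \<le> lookup a 0" if a: "a \<in> keys v" for a
  proof (cases "\<forall>j\<in>{1..n}. lookup a j = 1")
    case True
    then have "fibre_degree a = top_degree" by (simp add: fibre_degree_def top_degree_def)
    then show ?thesis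
      using v(1) a N3 monomial_degree_split[of a] by (auto simp: component_iff carrier_iff)
  next
    case False
    then have "fibre_degree a + 3 \<le> top_degree"
      using fibre_degree_not_top[OF component_in_carrier[OF v(1)] a] by blast
    moreover have "2 * lookup a 0 + fibre_degree a = top_degree - 1"
      using v(1) a monomial_degree_split[of a] by (auto simp: component_iff carrier_iff)
    ultimately show ?thesis by linarith
  qed
  then obtain v' where v': "v' \<in> component A (top_degree - 1 - 2 * 1)" "v = t_term 1 1 * v'"
    using t_divides[OF v(1), of 1] by blast
  have "D v = t_term 1 1 * D v'"
    unfolding v'(2) by (rule D_t_term_mult[OF component_in_carrier[OF v'(1)]])
  then have "single top 1 = t_term 1 1 * (w + D v')"
    using v(2) by (simp add: distrib_left algebra_simps)
  then have "top \<in> keys (t_term 1 1 * (w + D v'))"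
    using keys_single[of top "1::rat"] by simp
  from keys_single_mult[OF this] obtain b where "top = single 0 1 + b" by blast
  then have "lookup top 0 = 1 + lookup b 0" by (simp add: lookup_add)
  then show False by (simp add: lookup_top)
qed

lemma top_degree_le_formal_dimension:
  assumes "finite_dimensional H"
  shows "top_degree \<le> formal_dimension H + 1"
proof (cases "1 \<le> n")
  case True
  then obtain k where k: "top_degree \<le> k + 1" "component H k \<noteq> {\<zero>\<^bsub>H\<^esub>}"
    using nonzero_cohomology_near_top_degree by (metis le_add1 le_diff_conv order_refl)
  have "k \<le> formal_dimension H"
    unfolding formal_dimension_def using finitely_many_nonzero_degrees[OF assms] k(2)
    by (intro Max_ge) auto
  with k(1) show ?thesis by linarith
qed (simp add: top_degree_def)

section \<open>Primitives of powers of the base generator\<close>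

text \<open>If no monomial of \<open>z\<close> contains all odd generators, each has degree at most \<open>N - 3\<close> in them,
  and the rest of the degree \<open>2E - 1\<close> of \<open>z\<close> comes from \<open>t\<close>. As \<open>N - 1 \<le> 2m\<close>, the power of \<open>t\<close>
  with exponent \<open>E - m\<close> divides \<open>z\<close>, and the quotient shows that \<open>t\<^sup>m\<close> is exact. For \<open>E \<le> m\<close> this
  already follows by multiplication with a power of \<open>t\<close>.\<close>

lemma full_monomial_in_primitive:
  assumes m: "t_term 1 m \<notin> B" "top_degree \<le> 2 * m + 1"
    and z: "z \<in> component A k" "Suc k = 2 * E" "D z = t_term c E" "c \<noteq> 0"
  shows "\<exists>a\<in>keys z. \<forall>j\<in>{1..n}. lookup a j = 1"
proof (rule ccontr)
  assume no_top: "\<not> ?thesis"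
  have "\<exists>y\<in>carrier A. D y = t_term c m"
  proof (cases "E \<le> m")
    case True
    have "D (t_term 1 (m - E) * z) = t_term 1 (m - E) * t_term c E"
      using z(1,3) by (simp add: D_t_term_mult component_in_carrier)
    also have "\<dots> = t_term c m"
      using True by (simp add: mult_single single_add[symmetric])
    finally show ?thesis using z(1) t_term_mult_carrier component_in_carrier by blast
  next
    case False
    have "E - m \<le> lookup a 0" if a: "a \<in> keys z" for a
    proof -
      have "fibre_degree a + 3 \<le> top_degree"
        using no_top a fibre_degree_not_top[OF component_in_carrier[OF z(1)] a] by blast
      moreover have "2 * lookup a 0 + fibre_degree a = k"
        using z(1) a monomial_degree_split[of a] by (auto simp: component_iff carrier_iff)
      ultimately show ?thesis using m(2) z(2) by linarith
    qed
    then obtain y where y: "y \<in> component A (k - 2 * (E - m))" "z = t_term 1 (E - m) * y"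
      using t_divides[OF z(1)] by blast
    have "t_term 1 (E - m) * D y = t_term c E"
      using z(3) unfolding y(2) by (simp add: D_t_term_mult component_in_carrier[OF y(1)])
    also have "\<dots> = t_term 1 (E - m) * t_term c m"
      using False by (simp add: mult_single single_add[symmetric])
    finally have "D y = t_term c m" by (rule t_cancel) simp
    with component_in_carrier[OF y(1)] show ?thesis by blast
  qed
  then have "t_term c m \<in> B" using B_I by metis
  from B_t_term_mult[OF this, of 0 "1 / c"] have "t_term 1 m \<in> B"
    using z(4) by (simp add: mult_single)
  with m(1) show False by contradiction
qed

lemma odd_number_of_generators:
  assumes "a \<in> keys z" "z \<in> component A k" "Suc k = 2 * E" "\<forall>j\<in>{1..n}. lookup a j = 1"
  shows "odd n"
proof -
  have "2 * lookup a 0 + top_degree = k"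
    using assms monomial_degree_split[of a]
    by (auto simp: component_iff carrier_iff fibre_degree_def top_degree_def)
  moreover have "odd k" using assms(3) by (metis dvd_triv_left even_Suc)
  ultimately have "odd top_degree" by (metis dvd_triv_left even_add)
  moreover have "{j \<in> {1..n}. odd (deg j)} = {1..n}" using odd_deg by blast
  ultimately show ?thesis by (simp add: top_degree_def even_sum_iff)
qed

text \<open>
  Write \<open>D v\<^sub>l = T + \<alpha>\<close> with \<open>T = c t\<^sup>e\<close> and put \<open>y\<^sub>i = \<alpha>\<^sup>i\<close>. Since \<open>D (v\<^sub>l y\<^sub>i) = T y\<^sub>i + y\<^sub>i\<^sub>+\<^sub>1\<close>, the
  alternating sum of the elements \<open>T\<^sup>n\<^sup>-\<^sup>i v\<^sub>l y\<^sub>i\<close> has a telescoping differential, and what remains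
  is \<open>T\<^sup>n\<^sup>+\<^sup>1\<close> because \<open>y\<^sub>n\<^sub>+\<^sub>1 = 0\<close>. An additive weight \<open>f\<close> that vanishes on powers of \<open>t\<close> and is
  nonnegative on \<open>v\<^sub>l\<close> and on the monomials of \<open>\<alpha>\<close> is nonnegative on all monomials of the sum.
  The weight records which products of generators the primitive can contain.
\<close>

lemma primitive_with_nonnegative_weights:
  fixes f :: "monomial \<Rightarrow> int"
  assumes l: "l \<in> {1..n}" and e: "single 0 e \<in> keys (D (gen l))"
    and f_add: "\<And>a b. f (a + b) = f a + f b"
    and f_t: "\<And>b. f (single 0 b) = 0" and f_l: "0 \<le> f (single l 1)"
    and f_D: "\<And>a. a \<in> keys (D (gen l)) \<Longrightarrow> a \<noteq> single 0 e \<Longrightarrow> 0 \<le> f a"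
  obtains z k E c where "z \<in> component A k" "Suc k = 2 * E" "D z = t_term c E" "c \<noteq> 0"
    "\<And>a. a \<in> keys z \<Longrightarrow> 0 \<le> f a"
proof -
  define c where "c = lookup (D (gen l)) (single 0 e)"
  have c: "c \<noteq> 0" using e by (simp add: c_def in_keys_iff)
  have gen_l: "gen l \<in> component A (deg l)" using l by (intro gen_in_component) simp
  note Dgen = D_component[OF gen_l]
  have "2 * e = Suc (deg l)"
    using Dgen e by (auto simp: component_iff deg_t)
  then have e_pos: "0 < e" and t_in: "t_term c e \<in> component A (Suc (deg l))"
    using t_term_in_component[of e c] by simp_all
  define \<alpha> where "\<alpha> = D (gen l) - t_term c e"
  have \<alpha>: "\<alpha> \<in> component A (Suc (deg l))"
    unfolding \<alpha>_def using Dgen t_in by (rule component_diff)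
  have D_\<alpha>: "D \<alpha> = 0"
    unfolding \<alpha>_def using D_diff[OF component_in_carrier[OF Dgen] component_in_carrier[OF t_in]]
      D_D[OF component_in_carrier[OF gen_l]] D_t_term by simp
  have keys_\<alpha>: "a \<in> keys (D (gen l)) \<and> a \<noteq> single 0 e" if "a \<in> keys \<alpha>" for a
    using that by (auto simp: \<alpha>_def in_keys_iff lookup_minus c_def lookup_single when_def split: if_splits)
  \<comment> \<open>The number of odd generators in a monomial. It is at least \<open>i\<close> in \<open>\<alpha>\<^sup>i\<close> and never exceeds \<open>n\<close>,
    so \<open>\<alpha>\<close> is nilpotent.\<close>
  define len where "len a = (\<Sum>j\<in>{1..n}. lookup a j)" for a :: monomial
  have len_add: "len (a + b) = len a + len b" for a b
    by (simp add: len_def lookup_add sum.distrib)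
  have len_\<alpha>: "1 \<le> len a" if a: "a \<in> keys \<alpha>" for a
  proof (rule ccontr)
    assume "\<not> ?thesis"
    then have "len a = 0" by simp
    then have 0: "\<forall>j\<in>{1..n}. lookup a j = 0" unfolding len_def by (subst (asm) sum_eq_0_iff) auto
    have sub: "keys a \<subseteq> {0..n}" and "monomial_degree deg a = Suc (deg l)"
      using a \<alpha> by (auto simp: component_iff carrier_iff)
    with 0 have "lookup a 0 = e"
      using monomial_degree_split[OF sub] \<open>2 * e = _\<close> by (simp add: fibre_degree_def)
    moreover have "lookup a j = 0" if "j \<noteq> 0" for j
      using sub 0 that by (cases "j \<in> {1..n}") (force simp: in_keys_iff)+
    ultimately have "a = single 0 e"
      by (intro poly_mapping_eqI) (metis lookup_single_eq lookup_single_not_eq)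
    with keys_\<alpha>[OF a] show False by simp
  qed
  define y where "y i = (gca_mult deg \<alpha> ^^ i) 1" for i
  have y_Suc: "y (Suc i) = gca_mult deg \<alpha> (y i)" for i by (simp add: y_def)
  have y: "y i \<in> carrier A \<and> D (y i) = 0 \<and> (\<forall>a\<in>keys (y i). i \<le> len a \<and> 0 \<le> f a)" for i
  proof (induction i)
    case 0
    have "f 0 = 0" using f_t[of 0] by simp
    moreover have "D 1 = 0" using D_t_term[of 0 1] by simp
    ultimately show ?case
      using component_in_carrier[OF one_in_component] by (simp add: y_def)
  next
    case (Suc i)
    have "i + 1 \<le> len a \<and> 0 \<le> f a" if "a \<in> keys (gca_mult deg \<alpha> (y i))" for a
    proof -
      from that obtain b b' where b: "b \<in> keys \<alpha>" "b' \<in> keys (y i)" "a = b + b'"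
        by (rule keys_gca_mult)
      have "1 \<le> len b" "0 \<le> f b" "i \<le> len b'" "0 \<le> f b'"
        using len_\<alpha>[OF b(1)] f_D keys_\<alpha>[OF b(1)] Suc b(2) by blast+
      then show ?thesis unfolding b(3) len_add f_add by linarith
    qed
    moreover have "D (gca_mult deg \<alpha> (y i)) = 0"
      using D_leibniz[OF \<alpha>] Suc D_\<alpha> by simp
    ultimately show ?case
      using gca_mult_carrier[OF component_in_carrier[OF \<alpha>]] Suc by (simp add: y_Suc)
  qed
  have y_end: "y (Suc n) = 0"
  proof (rule ccontr)
    assume "y (Suc n) \<noteq> 0"
    then obtain a where a: "a \<in> keys (y (Suc n))"
      using Poly_Mapping.keys_eq_empty by blast
    have "len a \<le> (\<Sum>j\<in>{1..n}. 1)"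
      unfolding len_def using exponent_le_1 a y by (intro sum_mono) blast
    moreover have "Suc n \<le> len a" using y a by blast
    ultimately show False by simp
  qed
  have step: "D (gca_mult deg (gen l) (y i)) = t_term c e * y i + y (Suc i)" for i
  proof -
    have "D (gca_mult deg (gen l) (y i)) = gca_mult deg (t_term c e + \<alpha>) (y i)"
      using D_leibniz[OF gen_l, of "y i"] y[of i] by (simp add: \<alpha>_def)
    then show ?thesis
      using y[of i] by (simp add: gca_mult_add_left gca_mult_t_term y_Suc)
  qed
  have t_pow: "t_term c e ^ j = t_term (c ^ j) (e * j)" for j
    by (induction j) (simp_all add: mult_single single_add[symmetric])
  \<comment> \<open>The telescoping sum, built up one summand at a time from the end \<open>y\<^sub>n\<^sub>+\<^sub>1 = 0\<close>.\<close>
  have "\<exists>z\<in>carrier A. D z = t_term c e ^ j * y i \<and> (\<forall>a\<in>keys z. 0 \<le> f a)"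
    if "i + j = Suc n" for i j
    using that
  proof (induction j arbitrary: i)
    case 0
    then show ?case by (intro bexI[of _ 0]) (simp_all add: y_end)
  next
    case (Suc j)
    obtain z where z: "z \<in> carrier A" "D z = t_term c e ^ j * y (Suc i)" "\<forall>a\<in>keys z. 0 \<le> f a"
      using Suc.IH[of "Suc i"] Suc.prems by auto
    define u where "u = t_term c e ^ j * gca_mult deg (gen l) (y i)"
    have u_in: "gca_mult deg (gen l) (y i) \<in> carrier A"
      using gca_mult_carrier[OF component_in_carrier[OF gen_l]] y by blast
    have u: "u \<in> carrier A" unfolding u_def t_pow using u_in by (rule t_term_mult_carrier)
    have D_u: "D u = t_term c e ^ j * (t_term c e * y i + y (Suc i))"
      unfolding u_def t_pow using D_t_term_mult[OF u_in] step by simp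
    have "0 \<le> f a" if a: "a \<in> keys u" for a
    proof -
      obtain b where b: "b \<in> keys (gca_mult deg (gen l) (y i))" "a = single 0 (e * j) + b"
        using a keys_single_mult unfolding u_def t_pow by blast
      from b(1) obtain b1 b2 where "b1 \<in> keys (gen l)" "b2 \<in> keys (y i)" "b = b1 + b2"
        by (rule keys_gca_mult)
      with b(2) y[of i] f_l show ?thesis by (simp add: f_add f_t gen_def)
    qed
    moreover have "keys (u - z) \<subseteq> keys u \<union> keys z" by (rule Poly_Mapping.keys_diff)
    ultimately have "\<forall>a\<in>keys (u - z). 0 \<le> f a" using z(3) by blast
    moreover have "D (u - z) = t_term c e ^ Suc j * y i"
      using D_diff[OF u z(1)] D_u z(2) by (simp add: algebra_simps)
    ultimately show ?case using carrier_diff[OF u z(1)] by blast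
  qed
  from this[of 0 "Suc n"] obtain z where z: "z \<in> carrier A" "D z = t_term c e ^ Suc n * y 0"
    "\<forall>a\<in>keys z. 0 \<le> f a" by auto
  define E where "E = e * Suc n"
  have Dz: "D z = t_term (c ^ Suc n) E"
    using z(2) unfolding t_pow by (simp add: y_def E_def)
  have E: "Suc (2 * E - 1) = 2 * E" using e_pos by (simp add: E_def)
  have "t_term (c ^ Suc n) E \<in> component A (Suc (2 * E - 1))"
    unfolding E by (rule t_term_in_component)
  from exact_component[OF this Dz[symmetric] z(1)]
  obtain z' where "z' \<in> component A (2 * E - 1)" "D z' = t_term (c ^ Suc n) E" "keys z' \<subseteq> keys z"
    by auto
  moreover have "c ^ Suc n \<noteq> 0" using c by simp
  ultimately show ?thesis using that E z(3) by blast
qed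

text \<open>
  The pigeonhole argument, with blocks replaced by a weight: the number of \<open>Low\<close> generators minus
  the number of \<open>High\<close> generators in a monomial. A monomial of \<open>D v\<^sub>l\<close> other than the power of \<open>t\<close> has
  nonnegative weight, since it contains at most one \<open>High\<close> generator, and if one then
  also a \<open>Low\<close> one. The product of all odd generators has negative weight, as \<open>High\<close> has more elements
  than \<open>Low\<close>. The generator \<open>v\<^sub>l\<close> is put into neither set because it enters every monomial of the
  primitive as a factor of its own, outside of the blocks.
\<close>

lemma degree_inequality:
  assumes sorted: "\<And>i j. i \<in> {1..n} \<Longrightarrow> j \<in> {1..n} \<Longrightarrow> i \<le> j \<Longrightarrow> deg i \<le> deg j"
    and l: "l \<in> {1..n}" and e: "single 0 e \<in> keys (D (gen l))"
    and m: "t_term 1 m \<notin> B" "top_degree \<le> 2 * m + 1"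
    and i: "i \<in> {1..(n - 1) div 2}"
  shows "deg i + deg (n - i) \<le> deg n + 1"
proof (rule ccontr)
  assume "\<not> ?thesis"
  then have gt: "deg n + 1 < deg i + deg (n - i)" by simp
  have i': "1 \<le> i" "i \<le> n - i" "n - i \<le> n" using i by auto
  have far: "deg l + 1 < deg j + deg h" if "j \<in> {1..n}" "h \<in> {1..n}" "i \<le> j" "n - i \<le> h" for j h
    using gt sorted[of i j] sorted[of "n - i" h] sorted[of l n] that l i' by simp
  define High where "High = {n - i..n} - {l}"
  define Low where "Low = {1..<i} - {l}"
  define f where "f a = (\<Sum>j\<in>Low. int (lookup a j)) - (\<Sum>j\<in>High. int (lookup a j))"
    for a :: monomial
  have fin: "finite Low" "finite High" by (simp_all add: Low_def High_def)
  have f_add: "f (a + b) = f a + f b" for a b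
    by (simp add: f_def lookup_add sum.distrib)
  have "0 \<notin> Low" "0 \<notin> High" "l \<notin> Low" "l \<notin> High" using i' by (auto simp: Low_def High_def)
  then have "lookup (single 0 b) j = 0 \<and> lookup (single l (1::nat)) j = 0"
    if "j \<in> Low \<union> High" for b :: nat and j
    using that by (auto simp: lookup_single when_def)
  then have f_t: "f (single 0 b) = 0" and f_l: "f (single l 1) = 0" for b
    by (simp_all add: f_def)
  have f_D: "0 \<le> f a" if a: "a \<in> keys (D (gen l))" for a
  proof (cases "\<forall>h\<in>High. lookup a h = 0")
    case True
    then show ?thesis by (simp add: f_def sum_nonneg)
  next
    case False
    then obtain h where h: "h \<in> High" "lookup a h \<noteq> 0" by blast
    have h': "h \<in> {1..n}" "n - i \<le> h" using h(1) i' by (auto simp: High_def)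
    have Dl: "D (gen l) \<in> component A (Suc (deg l))"
      using l by (intro D_component gen_in_component) simp
    have le1: "lookup a j \<le> 1" if "j \<in> {1..n}" for j
      using exponent_le_1[OF component_in_carrier[OF Dl] a that] .
    have h1: "lookup a h = 1" using le1[OF h'(1)] h(2) by linarith
    have deg_a: "2 * lookup a 0 + fibre_degree a = Suc (deg l)"
      using Dl a monomial_degree_split[of a] by (auto simp: component_iff carrier_iff)
    have split: "fibre_degree a = deg h + (\<Sum>j\<in>{1..n} - {h}. deg j * lookup a j)"
      unfolding fibre_degree_def using h'(1) h1 by (simp add: sum.remove)
    have pair: "deg h + deg j \<le> deg l + 1" if j: "j \<in> {1..n} - {h}" "lookup a j \<noteq> 0" for j
    proof -
      have "deg j \<le> deg j * lookup a j" using j(2) by simp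
      also have "\<dots> \<le> (\<Sum>j\<in>{1..n} - {h}. deg j * lookup a j)"
        using j(1) by (intro member_le_sum) auto
      finally show ?thesis using split deg_a by linarith
    qed
    \<comment> \<open>The degree of \<open>a\<close> is even and that of the generator \<open>h\<close> is odd.\<close>
    have "\<exists>j\<in>{1..n} - {h}. lookup a j \<noteq> 0"
    proof (rule ccontr)
      assume "\<not> ?thesis"
      then have "2 * lookup a 0 + deg h = Suc (deg l)" using split deg_a by simp
      with odd_deg[OF h'(1)] odd_deg[OF l] show False by (metis dvd_triv_left even_Suc even_add)
    qed
    then obtain j where j: "j \<in> {1..n} - {h}" "lookup a j \<noteq> 0" by blast
    have "j < i" using far[of j h] pair[OF j] j(1) h' by force
    moreover have "j \<noteq> l" using pair[OF j] deg_gt[OF h'(1)] by auto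
    ultimately have j_Low: "j \<in> Low" using j(1) by (simp add: Low_def)
    have "lookup a h' = 0" if "h' \<in> High - {h}" for h'
    proof (rule ccontr)
      assume "lookup a h' \<noteq> 0"
      moreover have "h' \<in> {1..n} - {h}" "i \<le> h'" using that i' by (auto simp: High_def)
      ultimately show False using pair[of h'] far[of h' h] h' by force
    qed
    then have "(\<Sum>j\<in>High. int (lookup a j)) = 1"
      using sum.remove[OF fin(2) h(1), of "\<lambda>j. int (lookup a j)"] h1 by simp
    also have "1 \<le> int (lookup a j)" using j(2) by simp
    also have "\<dots> \<le> (\<Sum>j\<in>Low. int (lookup a j))"
      using j_Low fin(1) by (intro member_le_sum) auto
    finally show ?thesis by (simp add: f_def)
  qed
  obtain z k E c where z: "z \<in> component A k" "Suc k = 2 * E" "D z = t_term c E" "c \<noteq> 0"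
    "\<And>a. a \<in> keys z \<Longrightarrow> 0 \<le> f a"
    using primitive_with_nonnegative_weights[OF l e f_add f_t] f_l f_D by (metis order_refl)
  obtain a where a: "a \<in> keys z" "\<forall>j\<in>{1..n}. lookup a j = 1"
    using full_monomial_in_primitive[OF m z(1-4)] by blast
  have "Low \<subseteq> {1..n}" "High \<subseteq> {1..n}" using i' by (auto simp: Low_def High_def)
  then have "f a = int (card Low) - int (card High)"
    using a(2) by (simp add: f_def subset_iff)
  moreover have "card Low \<le> i - 1"
    using card_mono[of "{1..<i}" Low] by (auto simp: Low_def)
  moreover have "i \<le> card High"
    using i' diff_card_le_card_Diff[of "{l}" "{n - i..n}"] by (simp add: High_def)
  ultimately show False using z(5)[OF a(1)] i'(1) by linarith
qed

end

theorem theorem2p6: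
  fixes n :: nat and deg :: "nat \<Rightarrow> nat" and d :: "gca \<Rightarrow> gca"
  assumes "\<forall>i\<in>{1..n}. odd (deg i) \<and> 1 < deg i"
    and "\<forall>i\<in>{1..n}. \<forall>j\<in>{1..n}. i \<le> j \<longrightarrow> deg i \<le> deg j"
    and "minimal_sullivan_algebra {1..n} deg d"
    and "pre_c_symplectic n deg d"
  shows "odd n \<and> (\<forall>i\<in>{1..(n - 1) div 2}. deg i + deg (n - i) \<le> deg n + 1)"
proof -
  let ?deg = "deg(0 := 2)"
  have un: "{0} \<union> {1..n} = {0..n}" by auto
  obtain D where D: "relative_sullivan_algebra {0} {1..n} ?deg D"
    "D (gen 0) = \<zero>\<^bsub>free_gca {0..n} ?deg\<^esub>"
    "c_symplectic (cohomology (free_gca {0..n} ?deg) D)"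
    using assms(4) unfolding pre_c_symplectic_def Let_def by blast
  have "is_differential (free_gca {0..n} ?deg) D"
    using D(1) unfolding relative_sullivan_algebra_def Let_def un by blast
  then interpret odd_extension n ?deg D
    using assms(1) D(2) by unfold_locales (auto simp: free_gca_def)
  have fin: "finite_dimensional H"
    using D(3) by (simp add: c_symplectic_def poincare_duality_algebra_def)
  obtain m where m: "formal_dimension H = 2 * m" "t_term 1 m \<notin> B"
    using c_symplectic_t_power_not_exact[OF D(3)] by blast
  have top: "top_degree \<le> 2 * m + 1"
    using top_degree_le_formal_dimension[OF fin] m(1) by simp
  obtain z k E where z: "z \<in> component A k" "Suc k = 2 * E" "D z = t_term 1 E"
    using t_nilpotent_in_cohomology[OF fin] by blast
  obtain a where "a \<in> keys z" "\<forall>j\<in>{1..n}. lookup a j = 1"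
    using full_monomial_in_primitive[OF m(2) top z] by auto
  then have "odd n" using odd_number_of_generators z(1,2) by blast
  moreover have "deg i + deg (n - i) \<le> deg n + 1" if i: "i \<in> {1..(n - 1) div 2}" for i
  proof -
    obtain l e where l: "l \<in> {1..n}" "single 0 e \<in> keys (D (gen l))"
      using generator_hits_t_power[OF component_in_carrier[OF z(1)] z(3)] by auto
    have sorted: "?deg i \<le> ?deg j" if "i \<in> {1..n}" "j \<in> {1..n}" "i \<le> j" for i j
      using assms(2) that by auto
    have "?deg i + ?deg (n - i) \<le> ?deg n + 1"
      using degree_inequality[OF sorted l m(2) top i] by blast
    moreover have "i \<noteq> 0" "n - i \<noteq> 0" "n \<noteq> 0" using i by auto
    ultimately show ?thesis by simp
  qed
  ultimately show ?thesis by blast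
qed

end
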